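(* Let $\mu\in\mathbb R$, $\alpha>0$. The $a$-periodic functions $\varphi_\pm$ associated with the Floquet solutions of the periodic Dirac equation have asymptotics $$|\varphi_\pm(x,\mu+i\alpha)|=|\varphi_\pm(0,\mu+i\alpha)|\left(1+O_{\rm unif}\left(\tfrac1\alpha\right)\right)\qquad(\alpha\to\infty)$$ uniformly in $x\in[0,a]$. Consequently, the functions $\gamma_\pm$ satisfy $$\gamma_\pm(\mu+i\alpha)=1+O\left(\tfrac1\alpha\right)\qquad(\alpha\to\infty).$$
   Context: Setting: $m\ge0$, $a>0$, and $q:\mathbb R\to\mathbb R$ is locally integrable and $a$-periodic. Pauli matrices: $\sigma_2=\begin{pmatrix}0&-i\\i&0\end{pmatrix}$, $\sigma_3=\begin{pmatrix}1&0\\0&-1\end{pmatrix}$; $\mathbb I$ is the $2\times2$ unit matrix; $|w|=\sqrt{|w_1|^2+|w_2|^2}$ for $w\in\mathbb C^2$. $O_{\rm unif}$ means that the bound is uniform in $x\in[0,a]$. For $\lambda\in\mathbb C$, $\Phi(\cdot,\lambda)$ is the $2\times2$ matrix solution of the periodic Dirac equation $-i\sigma_2\Phi'+(m\sigma_3+q)\Phi=\lambda\Phi$ on $\mathbb R$ with $\Phi(0,\lambda)=\mathbb I$. The monodromy matrix is $M(\lambda)=\Phi(a,\lambda)$ (of determinant 1), the discriminant is $\mathfrak D(\lambda)=\operatorname{Tr}M(\lambda)$; $\mathfrak D(\lambda)\in[-2,2]$ only for real $\lambda$. Quasimomentum: on $\{\operatorname{Im}\lambda\ge0\}$, $k$ is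 a continuous function with $\mathfrak D(\lambda)=2\cos(k(\lambda)a)$ and $\operatorname{Im}k(\lambda)\ge0$. If $\mathfrak D(\lambda)\notin[-2,2]$ and $\operatorname{Im}\lambda\ge0$, the eigenvalues of $M(\lambda)$ are $\rho(\lambda)=e^{-ik(\lambda)a}$ (outside the unit circle) and $1/\rho(\lambda)=e^{ik(\lambda)a}$ (inside the unit circle); $v_+(\lambda),v_-(\lambda)\in\mathbb C^2\setminus\{0\}$ denote corresponding eigenvectors, respectively. The functions $\varphi_\pm(x,\lambda)=e^{\pm ik(\lambda)x}\,\Phi(x,\lambda)v_\pm(\lambda)$ are $a$-periodic in $x$, and $$\gamma_\pm(\lambda)=\frac{|\varphi_\pm(0,\lambda)|}{\sup_{x\in[0,a]}|\varphi_\pm(x,\lambda)|}.$$ *)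

theory Defs
  imports "HOL-Analysis.Analysis" "HOL-Library.Landau_Symbols"
begin

definition sigma2 :: "complex^2^2" where
  "sigma2 = vector [vector [0, - \<i>], vector [\<i>, 0]]"

definition sigma3 :: "complex^2^2" where
  "sigma3 = vector [vector [1, 0], vector [0, - 1]]"

definition locally_integrable :: "(real \<Rightarrow> real) \<Rightarrow> bool" where
  "locally_integrable q \<longleftrightarrow> (\<forall>K. compact K \<longrightarrow> q absolutely_integrable_on K)"

text \<open>Absolute continuity on the interval from \<open>c\<close> to \<open>d\<close>, in the usual epsilon-delta form.  A pair
  \<open>(u, v)\<close> stands for the open interval from \<open>u\<close> to \<open>v\<close>; degenerate pairs contribute nothing.\<close>

definition abs_continuous_on :: "real \<Rightarrow> real \<Rightarrow> (real \<Rightarrow> 'a::real_normed_vector) \<Rightarrow> bool" where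
  "abs_continuous_on c d f \<longleftrightarrow>
    (\<forall>\<epsilon>>0. \<exists>\<delta>>0. \<forall>I. finite I \<longrightarrow> (\<forall>(u, v)\<in>I. c \<le> u \<and> u \<le> v \<and> v \<le> d) \<longrightarrow>
       disjoint_family_on (\<lambda>(u, v). {u<..<v}) I \<longrightarrow> (\<Sum>(u, v)\<in>I. v - u) < \<delta> \<longrightarrow>
       (\<Sum>(u, v)\<in>I. norm (f v - f u)) < \<epsilon>)"

definition locally_abs_continuous :: "(real \<Rightarrow> 'a::real_normed_vector) \<Rightarrow> bool" where
  "locally_abs_continuous f \<longleftrightarrow> (\<forall>c d. abs_continuous_on c d f)"

text \<open>The equation \<open>- i \<sigma>\<^sub>2 Y' + (m \<sigma>\<^sub>3 + q) Y = \<lambda> Y\<close>.  As \<open>q\<close> is merely locally integrable, a solution is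
  a locally absolutely continuous function satisfying the equation almost everywhere.  The spectral
  parameter \<open>\<lambda>\<close> is called \<open>z\<close> below, and the complex multiple \<open>c A\<close> of a matrix is written \<open>mat c ** A\<close>.\<close>

definition dirac_solution ::
  "real \<Rightarrow> (real \<Rightarrow> real) \<Rightarrow> complex \<Rightarrow> (real \<Rightarrow> complex^2^2) \<Rightarrow> bool" where
  "dirac_solution m q z Y \<longleftrightarrow> locally_abs_continuous Y \<and>
    (AE x in lebesgue. \<exists>Y'. (Y has_vector_derivative Y') (at x) \<and>
       mat (- \<i>) ** sigma2 ** Y'
         + (mat (of_real m) ** sigma3 + mat (of_real (q x))) ** Y x = mat z ** Y x)"

definition fundamental_matrix ::
  "real \<Rightarrow> (real \<Rightarrow> real) \<Rightarrow> (real \<Rightarrow> complex \<Rightarrow> complex^2^2) \<Rightarrow> bool" where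
  "fundamental_matrix m q \<Phi> \<longleftrightarrow>
    (\<forall>z. dirac_solution m q z (\<lambda>x. \<Phi> x z) \<and> \<Phi> 0 z = mat 1)"

definition monodromy :: "real \<Rightarrow> (real \<Rightarrow> complex \<Rightarrow> complex^2^2) \<Rightarrow> complex \<Rightarrow> complex^2^2" where
  "monodromy a \<Phi> z = \<Phi> a z"

definition discriminant :: "real \<Rightarrow> (real \<Rightarrow> complex \<Rightarrow> complex^2^2) \<Rightarrow> complex \<Rightarrow> complex" where
  "discriminant a \<Phi> z = trace (monodromy a \<Phi> z)"

definition quasimomentum ::
  "real \<Rightarrow> (real \<Rightarrow> complex \<Rightarrow> complex^2^2) \<Rightarrow> (complex \<Rightarrow> complex) \<Rightarrow> bool" where
  "quasimomentum a \<Phi> k \<longleftrightarrow> continuous_on {z. Im z \<ge> 0} k \<and>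
    (\<forall>z. Im z \<ge> 0 \<longrightarrow> discriminant a \<Phi> z = 2 * cos (k z * of_real a) \<and> Im (k z) \<ge> 0)"

definition eigenvector_for :: "complex^2^2 \<Rightarrow> complex \<Rightarrow> complex^2 \<Rightarrow> bool" where
  "eigenvector_for A \<rho> v \<longleftrightarrow> v \<noteq> 0 \<and> A *v v = \<rho> *s v"

definition floquet_eigenvectors ::
  "real \<Rightarrow> (real \<Rightarrow> complex \<Rightarrow> complex^2^2) \<Rightarrow> (complex \<Rightarrow> complex)
     \<Rightarrow> (complex \<Rightarrow> complex^2) \<Rightarrow> (complex \<Rightarrow> complex^2) \<Rightarrow> bool" where
  "floquet_eigenvectors a \<Phi> k vp vm \<longleftrightarrow>
    (\<forall>z. Im z \<ge> 0 \<longrightarrow> discriminant a \<Phi> z \<notin> of_real ` {-2..2} \<longrightarrow>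
       eigenvector_for (monodromy a \<Phi> z) (exp (- \<i> * k z * of_real a)) (vp z) \<and>
       eigenvector_for (monodromy a \<Phi> z) (exp (\<i> * k z * of_real a)) (vm z))"

definition phi_plus ::
  "(real \<Rightarrow> complex \<Rightarrow> complex^2^2) \<Rightarrow> (complex \<Rightarrow> complex) \<Rightarrow> (complex \<Rightarrow> complex^2)
     \<Rightarrow> real \<Rightarrow> complex \<Rightarrow> complex^2" where
  "phi_plus \<Phi> k vp x z = exp (\<i> * k z * of_real x) *s (\<Phi> x z *v vp z)"

definition phi_minus ::
  "(real \<Rightarrow> complex \<Rightarrow> complex^2^2) \<Rightarrow> (complex \<Rightarrow> complex) \<Rightarrow> (complex \<Rightarrow> complex^2)
     \<Rightarrow> real \<Rightarrow> complex \<Rightarrow> complex^2" where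
  "phi_minus \<Phi> k vm x z = exp (- \<i> * k z * of_real x) *s (\<Phi> x z *v vm z)"

text \<open>The quotient \<open>\<gamma>\<close> of a function \<open>\<phi>\<close>.  The norm on \<^typ>\<open>complex^2\<close> is the Euclidean one.\<close>

definition gamma_quot :: "real \<Rightarrow> (real \<Rightarrow> complex \<Rightarrow> complex^2) \<Rightarrow> complex \<Rightarrow> real" where
  "gamma_quot a \<phi> z = norm (\<phi> 0 z) / (SUP x\<in>{0..a}. norm (\<phi> x z))"

text \<open>\<open>r(x, \<alpha>) = O(g(\<alpha>))\<close> as \<open>\<alpha> \<rightarrow> \<infinity>\<close>, with constant and threshold independent of \<open>x\<close>
  in the interval from \<open>0\<close> to \<open>a\<close>.\<close>

definition unif_bigo :: "real \<Rightarrow> (real \<Rightarrow> real \<Rightarrow> real) \<Rightarrow> (real \<Rightarrow> real) \<Rightarrow> bool" where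
  "unif_bigo a r g \<longleftrightarrow>
    (\<exists>C. eventually (\<lambda>\<alpha>. \<forall>x\<in>{0..a}. \<bar>r x \<alpha>\<bar> \<le> C * \<bar>g \<alpha>\<bar>) at_top)"

end

theory Submission
  imports Defs
begin

text \<open>
  For a solution \<open>y\<close> with \<open>\<lambda> = \<mu> + i\<alpha>\<close> put \<open>u = y\<^sub>1 - i y\<^sub>2\<close>, \<open>w = y\<^sub>1 + i y\<^sub>2\<close>, \<open>U = |u|\<^sup>2\<close>,
  \<open>W = |w|\<^sup>2\<close>.  As \<open>q\<close> and \<open>\<mu>\<close> are real, they drop out of \<open>U' = -2\<alpha>U + c\<close>, \<open>W' = 2\<alpha>W + c\<close>, where
  \<open>|c| \<le> 2m sqrt (UW)\<close>.  The difference \<open>U - W\<close> decreases strictly, so no multiplier is unimodular, and for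
  the growing Floquet solution \<open>U < W\<close>.  The periodic quotient \<open>U/W\<close> is then at most \<open>(m/2\<alpha>)\<^sup>2\<close> by a
  maximum principle, whence \<open>N = U + W = 2|y|\<^sup>2\<close> satisfies \<open>(ln N)' = 2\<alpha> + O(1/\<alpha>)\<close>.  Integrating over
  a period gives \<open>Im k = \<alpha> + O(1/\<alpha>)\<close>, and integrating up to \<open>x\<close> gives \<open>exp (-2x Im k) N(x) = N(0) (1 + O(1/\<alpha>))\<close>.
  The decaying solution reduces to this one by the reflection \<open>x \<mapsto> a - x\<close>.
\<close>

section \<open>Absolutely continuous functions\<close>

text \<open>Bridge from finite families of endpoint pairs, as in the definition of absolute
  continuity, to the tagged divisions of gauge integration. The nondegenerate pieces have disjoint
  interiors, so their total length is the measure of their union, which lies inside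
  \<open>T\<close>.\<close>

lemma tagged_partial_division_increments_lt:
  fixes f :: "real \<Rightarrow> 'a::real_normed_vector"
  assumes \<delta>: "\<And>I. finite I \<Longrightarrow> (\<forall>(u, v)\<in>I. a \<le> u \<and> u \<le> v \<and> v \<le> b) \<Longrightarrow>
       disjoint_family_on (\<lambda>(u, v). {u<..<v}) I \<Longrightarrow> (\<Sum>(u, v)\<in>I. v - u) < \<delta> \<Longrightarrow>
       (\<Sum>(u, v)\<in>I. norm (f v - f u)) < \<epsilon>"
    and p: "p tagged_partial_division_of {a..b}"
    and T: "T \<in> lmeasurable" "measure lebesgue T < \<delta>"
    and sub: "\<And>x K. (x, K) \<in> p \<Longrightarrow> K \<subseteq> T"
  shows "(\<Sum>(x, K)\<in>p. norm (f (Sup K) - f (Inf K))) < \<epsilon>"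
proof -
  note pD = tagged_partial_division_ofD[OF p]
  have ival: "\<exists>u v. u \<le> v \<and> K = {u..v} \<and> a \<le> u \<and> v \<le> b" if xK: "(x, K) \<in> p" for x K
  proof -
    obtain u v where "K = {u..v}" using pD(4)[OF xK] by (auto simp: box_real)
    then show ?thesis using pD(2,3)[OF xK] by auto
  qed
  \<comment> \<open>A degenerate interval could occur under several tags, and passing to endpoint
    pairs would then merge them. Only nondegenerate pieces are kept; the discarded ones have
    increment zero.\<close>
  define B where "B = {(x, K)\<in>p. interior K \<noteq> {}}"
  have Bp: "B \<subseteq> p" by (auto simp: B_def)
  have finB: "finite B" using pD(1) Bp finite_subset by blast
  have eqI: "K = L" if "(x, K) \<in> p" "(y, L) \<in> p" "Inf K = Inf L" "Sup K = Sup L" for x y K L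
    using ival[OF that(1)] ival[OF that(2)] that(3,4) by fastforce
  have inj: "inj_on (\<lambda>(x, K). (Inf K, Sup K)) B"
    unfolding inj_on_def
  proof (clarsimp)
    fix x K y L assume *: "(x, K) \<in> B" "(y, L) \<in> B" "Inf K = Inf L" "Sup K = Sup L"
    then have "K = L" using eqI Bp by blast
    moreover have "x = y"
    proof (rule ccontr)
      assume "x \<noteq> y"
      then have "interior K \<inter> interior L = {}" using pD(5)[of x K y L] * Bp by blast
      then show False using * \<open>K = L\<close> by (auto simp: B_def)
    qed
    ultimately show "x = y \<and> K = L" by simp
  qed
  define I where "I = (\<lambda>(x, K). (Inf K, Sup K)) ` B"
  have 1: "finite I" using finB by (simp add: I_def)
  have 2: "\<forall>(u, v)\<in>I. a \<le> u \<and> u \<le> v \<and> v \<le> b"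
    using ival Bp by (fastforce simp: I_def)
  have 3: "disjoint_family_on (\<lambda>(u, v). {u<..<v}) I"
    unfolding disjoint_family_on_def
  proof (intro ballI impI)
    fix i j assume ij: "i \<in> I" "j \<in> I" "i \<noteq> j"
    then obtain x K y L where *: "(x, K) \<in> B" "(y, L) \<in> B" "i = (Inf K, Sup K)" "j = (Inf L, Sup L)"
      unfolding I_def by (auto simp: image_iff)
    have "(x, K) \<noteq> (y, L)" using * ij by auto
    then have d: "interior K \<inter> interior L = {}" using pD(5) * Bp by blast
    obtain u v u' v' where "K = {u..v}" "u \<le> v" "L = {u'..v'}" "u' \<le> v'"
      using ival * Bp by (meson subsetD)
    then show "(case i of (u, v) \<Rightarrow> {u<..<v}) \<inter> (case j of (u, v) \<Rightarrow> {u<..<v}) = {}"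
      using d * by (simp add: interior_atLeastAtMost_real)
  qed
  have inj2: "inj_on snd B"
    using inj unfolding inj_on_def by fastforce
  have div: "(snd ` B) division_of \<Union>(snd ` B)"
    by (rule partial_division_of_tagged_division[OF tagged_partial_division_subset[OF p Bp]])
  have "(\<Sum>(u, v)\<in>I. v - u) = (\<Sum>(x, K)\<in>B. Sup K - Inf K)"
    unfolding I_def by (subst sum.reindex[OF inj]) (simp add: case_prod_unfold)
  also have "\<dots> = (\<Sum>(x, K)\<in>B. measure lebesgue K)"
  proof (rule sum.cong[OF refl], clarify)
    fix x K assume "(x, K) \<in> B"
    then obtain u v where "u \<le> v" "K = {u..v}" using ival Bp by blast
    then show "Sup K - Inf K = measure lebesgue K" by simp
  qed
  also have "\<dots> = (\<Sum>K\<in>snd ` B. measure lebesgue K)"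
    by (subst sum.reindex[OF inj2]) (simp add: case_prod_unfold)
  also have "\<dots> = measure lebesgue (\<Union>(snd ` B))"
    using content_division[OF div] by simp
  also have "\<dots> \<le> measure lebesgue T"
  proof (rule measure_mono_fmeasurable)
    show "\<Union>(snd ` B) \<subseteq> T" using sub Bp by fastforce
  qed (use lmeasurable_division[OF div] T in auto)
  finally have 4: "(\<Sum>(u, v)\<in>I. v - u) < \<delta>" using T by simp
  have "(\<Sum>(x, K)\<in>p. norm (f (Sup K) - f (Inf K))) = (\<Sum>(x, K)\<in>B. norm (f (Sup K) - f (Inf K)))"
  proof (rule sum.mono_neutral_right[OF pD(1) Bp], clarify)
    fix x K assume *: "(x, K) \<in> p" "(x, K) \<notin> B"
    then obtain u v where uv: "u \<le> v" "K = {u..v}" using ival by blast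
    have "interior K = {}" using * by (simp add: B_def)
    then have "u = v" using uv by (simp add: interior_atLeastAtMost_real)
    then show "norm (f (Sup K) - f (Inf K)) = 0" using uv by simp
  qed
  also have "\<dots> = (\<Sum>(u, v)\<in>I. norm (f v - f u))"
    unfolding I_def by (subst sum.reindex[OF inj]) (simp add: case_prod_unfold)
  finally show ?thesis using \<delta>[OF 1 2 3 4] by simp
qed

lemma abs_continuous_onE:
  assumes "abs_continuous_on a b f" "\<epsilon> > 0"
  obtains \<delta> where "\<delta> > 0" and "\<And>I. finite I \<Longrightarrow> (\<forall>(u, v)\<in>I. a \<le> u \<and> u \<le> v \<and> v \<le> b) \<Longrightarrow>
       disjoint_family_on (\<lambda>(u, v). {u<..<v}) I \<Longrightarrow> (\<Sum>(u, v)\<in>I. v - u) < \<delta> \<Longrightarrow>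
       (\<Sum>(u, v)\<in>I. norm (f v - f u)) < \<epsilon>"
  using assms unfolding abs_continuous_on_def by meson

text \<open>Fundamental theorem of calculus by a direct gauge argument, in which integrability of
  \<open>g\<close> is part of the outcome. At tags outside \<open>N\<close> differentiability
  controls the error; intervals tagged in \<open>N\<close> are confined to an open set of small
  measure, where absolute continuity makes the sum of the increments small.\<close>

lemma abs_continuous_on_has_integral:
  fixes f g :: "real \<Rightarrow> 'a::banach"
  assumes ac: "abs_continuous_on a b f" and "a \<le> b" and N: "negligible N"
    and der: "\<And>x. x \<in> {a..b} - N \<Longrightarrow> (f has_vector_derivative g x) (at x within {a..b})"
  shows "(g has_integral f b - f a) {a..b}"
proof -
  \<comment> \<open>With value 0 on \<open>N\<close>, tags in \<open>N\<close> contribute only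
    increments of \<open>f\<close> to the error. Changing back to \<open>g\<close> affects a
    negligible set and is done at the very end.\<close>
  define h where "h x = (if x \<in> N then 0 else g x)" for x
  have "(h has_integral f b - f a) {a..b}"
    unfolding has_integral_real
  proof (intro allI impI)
    fix e :: real assume "e > 0"
    \<comment> \<open>Half of \<open>e\<close> is spent on the good tags, the other half on the bad
      ones. The summand 1 keeps the denominator positive when \<open>a = b\<close>.\<close>
    define e' where "e' = e / (2 * (b - a + 1))"
    have e': "e' > 0" "e' * (b - a) \<le> e / 2"
      using \<open>e > 0\<close> \<open>a \<le> b\<close> by (auto simp: e'_def field_simps)
    have "e / 2 > 0" using \<open>e > 0\<close> by simp
    obtain \<delta> where "\<delta> > 0" and \<delta>: "\<And>I. finite I \<Longrightarrow> (\<forall>(u, v)\<in>I. a \<le> u \<and> u \<le> v \<and> v \<le> b) \<Longrightarrow>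
       disjoint_family_on (\<lambda>(u, v). {u<..<v}) I \<Longrightarrow> (\<Sum>(u, v)\<in>I. v - u) < \<delta> \<Longrightarrow>
       (\<Sum>(u, v)\<in>I. norm (f v - f u)) < e / 2"
      by (rule abs_continuous_onE[OF ac \<open>e / 2 > 0\<close>]) (rule that)
    have Nm: "N \<in> lmeasurable" "measure lebesgue N = 0"
      using N negligible_imp_measurable negligible_imp_measure0 by auto
    obtain T where T: "open T" "N \<subseteq> T" "T - N \<in> lmeasurable" "emeasure lebesgue (T - N) < ennreal \<delta>"
      by (rule sets_lebesgue_outer_open[OF fmeasurableD[OF Nm(1)] \<open>\<delta> > 0\<close>])
    have TN: "N \<union> (T - N) = T" using T(2) by blast
    have T3: "T \<in> lmeasurable" using fmeasurable.Un[OF Nm(1) T(3)] unfolding TN .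
    have "measure lebesgue T \<le> measure lebesgue N + measure lebesgue (T - N)"
      using measure_Un_le[OF fmeasurableD[OF Nm(1)] fmeasurableD[OF T(3)]] unfolding TN .
    moreover have "measure lebesgue (T - N) < \<delta>"
      using T(3,4) \<open>\<delta> > 0\<close> by (simp add: emeasure_eq_measure2 ennreal_less_iff)
    ultimately have T4: "measure lebesgue T < \<delta>" using Nm(2) by simp
    have "\<forall>x. \<exists>d>0. x \<in> {a..b} - N \<longrightarrow>
        (\<forall>y\<in>{a..b}. norm (y-x) < d \<longrightarrow> norm (f y - f x - (y-x) *\<^sub>R g x) \<le> e' * norm (y-x))"
    proof
      fix x
      show "\<exists>d>0. x \<in> {a..b} - N \<longrightarrow>
        (\<forall>y\<in>{a..b}. norm (y-x) < d \<longrightarrow> norm (f y - f x - (y-x) *\<^sub>R g x) \<le> e' * norm (y-x))"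
      proof (cases "x \<in> {a..b} - N")
        case True
        then show ?thesis
          using der[OF True, unfolded has_vector_derivative_def has_derivative_within_alt] e'(1) by blast
      next
        case False
        then show ?thesis by (intro exI[of _ 1]) auto
      qed
    qed
    then obtain d where d': "\<forall>x. d x > 0 \<and> (x \<in> {a..b} - N \<longrightarrow>
        (\<forall>y\<in>{a..b}. norm (y-x) < d x \<longrightarrow> norm (f y - f x - (y-x) *\<^sub>R g x) \<le> e' * norm (y-x)))"
      by (rule choice[THEN exE])
    have d0: "d x > 0" for x using d' by blast
    have d: "norm (f y - f x - (y-x) *\<^sub>R g x) \<le> e' * norm (y-x)"
      if "x \<in> {a..b} - N" "y \<in> {a..b}" "norm (y-x) < d x" for x y
      using d' that by blast
    \<comment> \<open>Fineness forces an interval tagged in \<open>N\<close> into \<open>T\<close>,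
      and any other one into the neighbourhood where the linear approximation at its tag has
      relative error at most \<open>e'\<close>.\<close>
    define \<gamma> where "\<gamma> x = (if x \<in> N then T else ball x (d x))" for x
    have "gauge \<gamma>"
      using T d0 by (auto simp: gauge_def \<gamma>_def)
    moreover have "norm ((\<Sum>(x, K)\<in>p. measure lborel K *\<^sub>R h x) - (f b - f a)) < e"
      if ptag: "p tagged_division_of {a..b}" and fine: "\<gamma> fine p" for p
    proof -
      define B where "B = {(x, K)\<in>p. x \<in> N}"
      define G where "G = {(x, K)\<in>p. x \<notin> N}"
      have pGB: "p = G \<union> B" "G \<inter> B = {}" by (auto simp: B_def G_def)
      have finp: "finite p" using tagged_division_ofD(1)[OF ptag] .
      then have fin: "finite G" "finite B" using pGB by auto
      have ba: "b - a = (\<Sum>(x,K)\<in>p. Sup K - Inf K)" "f b - f a = (\<Sum>(x,K)\<in>p. f(Sup K) - f(Inf K))"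
        using additive_tagged_division_1[where f= "\<lambda>x. x"] additive_tagged_division_1[where f= f]
              \<open>a \<le> b\<close> ptag by auto
      have ival: "\<exists>u v. u \<le> v \<and> K = {u..v} \<and> a \<le> u \<and> v \<le> b \<and> u \<le> x \<and> x \<le> v" if "(x, K) \<in> p" for x K
      proof -
        have "x \<in> K" "K \<subseteq> {a..b}" "\<exists>u v. K = cbox u v"
          using tagged_division_ofD(2-4)[OF ptag that] by auto
        then show ?thesis by (auto simp: box_real)
      qed
      have bad: "(\<Sum>(x,K)\<in>B. norm (f(Sup K) - f(Inf K))) < e / 2"
      proof (rule tagged_partial_division_increments_lt[OF \<delta> _ T3 T4])
        show "B tagged_partial_division_of {a..b}"
          using ptag pGB tagged_partial_division_subset[of p "{a..b}" B]
          by (simp add: tagged_division_of_def)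
        show "K \<subseteq> T" if "(x, K) \<in> B" for x K
          using fineD[OF fine, of x K] that by (simp add: B_def \<gamma>_def)
      qed
      \<comment> \<open>Straddle estimate: the tag lies between the endpoints, so its distances to
        them add up to the length of the interval.\<close>
      have good: "norm (measure lborel K *\<^sub>R h x - (f (Sup K) - f (Inf K))) \<le> e' * (Sup K - Inf K)"
        if "(x, K) \<in> G" for x K
      proof -
        have xN: "x \<notin> N" "(x, K) \<in> p" using that by (auto simp: G_def)
        then obtain u v where k: "u \<le> v" "K = {u..v}" "a \<le> u" "v \<le> b" "u \<le> x" "x \<le> v"
          using ival[OF xN(2)] by blast
        from xN have "K \<subseteq> ball x (d x)" using fineD[OF fine, of x K] by (simp add: \<gamma>_def)
        moreover have "u \<in> K" "v \<in> K" using k by auto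
        ultimately have "u \<in> ball x (d x)" "v \<in> ball x (d x)" by blast+
        then have "norm (u - x) < d x" "norm (v - x) < d x"
          by (simp_all add: dist_norm norm_minus_commute)
        moreover have "x \<in> {a..b} - N" "u \<in> {a..b}" "v \<in> {a..b}" using xN k by auto
        ultimately have *: "norm (f u - f x - (u-x) *\<^sub>R g x) \<le> e' * norm (u-x)"
          "norm (f v - f x - (v-x) *\<^sub>R g x) \<le> e' * norm (v-x)"
          using d[of x u] d[of x v] by simp_all
        have "norm ((v - u) *\<^sub>R g x - (f v - f u)) = norm (f u - f x - (u - x) *\<^sub>R g x - (f v - f x - (v - x) *\<^sub>R g x))"
          by (auto simp: algebra_simps)
        also have "\<dots> \<le> norm (f u - f x - (u - x) *\<^sub>R g x) + norm (f v - f x - (v - x) *\<^sub>R g x)"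
          by (rule norm_triangle_ineq4)
        also have "\<dots> \<le> e' * (x - u) + e' * (v - x)" using * k by auto
        also have "\<dots> = e' * (v - u)" by (simp add: algebra_simps)
        finally show ?thesis using k xN by (simp add: h_def)
      qed
      have "(\<Sum>(x, K)\<in>p. measure lborel K *\<^sub>R h x) - (f b - f a)
          = (\<Sum>(x, K)\<in>p. measure lborel K *\<^sub>R h x - (f (Sup K) - f (Inf K)))"
        unfolding ba by (simp add: sum_subtractf case_prod_unfold)
      also have "\<dots> = (\<Sum>(x, K)\<in>G. measure lborel K *\<^sub>R h x - (f (Sup K) - f (Inf K)))
            + (\<Sum>(x, K)\<in>B. measure lborel K *\<^sub>R h x - (f (Sup K) - f (Inf K)))"
        using pGB fin by (simp add: sum.union_disjoint)
      finally have "norm ((\<Sum>(x, K)\<in>p. measure lborel K *\<^sub>R h x) - (f b - f a)) \<le>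
         norm (\<Sum>(x, K)\<in>G. measure lborel K *\<^sub>R h x - (f (Sup K) - f (Inf K)))
            + norm (\<Sum>(x, K)\<in>B. measure lborel K *\<^sub>R h x - (f (Sup K) - f (Inf K)))"
        by (simp add: norm_triangle_ineq)
      moreover have "norm (\<Sum>(x, K)\<in>B. measure lborel K *\<^sub>R h x - (f (Sup K) - f (Inf K)))
           \<le> (\<Sum>(x,K)\<in>B. norm (f(Sup K) - f(Inf K)))"
        by (rule sum_norm_le) (auto simp: B_def h_def norm_minus_commute)
      moreover have "norm (\<Sum>(x, K)\<in>G. measure lborel K *\<^sub>R h x - (f (Sup K) - f (Inf K)))
           \<le> (\<Sum>(x,K)\<in>G. e' * (Sup K - Inf K))"
        using good by (intro sum_norm_le) auto
      moreover have "(\<Sum>(x,K)\<in>G. e' * (Sup K - Inf K)) \<le> (\<Sum>(x,K)\<in>p. e' * (Sup K - Inf K))"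
      proof (rule sum_mono2[OF finp])
        show "0 \<le> (case i of (x, K) \<Rightarrow> e' * (Sup K - Inf K))" if "i \<in> p - G" for i
        proof -
          obtain x K where i: "i = (x, K)" by fastforce
          then have "(x, K) \<in> p" using that by auto
          then obtain u v where "u \<le> v" "K = {u..v}" using ival by blast
          then show ?thesis using e' i by simp
        qed
      qed (use pGB in auto)
      moreover have "(\<Sum>(x,K)\<in>p. e' * (Sup K - Inf K)) = e' * (b - a)"
        unfolding ba(1) by (simp add: sum_distrib_left case_prod_unfold)
      ultimately show ?thesis using bad e'(2) by linarith
    qed
    ultimately show "\<exists>\<gamma>. gauge \<gamma> \<and> (\<forall>p. p tagged_division_of {a..b} \<and> \<gamma> fine p \<longrightarrow>
        norm ((\<Sum>(x, K)\<in>p. measure lborel K *\<^sub>R h x) - (f b - f a)) < e)" by (intro exI[of _ \<gamma>]) simp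
  qed
  then show ?thesis
    by (rule has_integral_spike[OF N, rotated]) (auto simp: h_def)
qed

section \<open>Closure properties of absolute continuity and the passage to classical
  derivatives\<close>

lemma abs_continuous_on_subinterval:
  assumes "abs_continuous_on a b f" "a \<le> c" "d \<le> b"
  shows "abs_continuous_on c d f"
  unfolding abs_continuous_on_def
proof (intro allI impI)
  fix \<epsilon> :: real assume "\<epsilon> > 0"
  obtain \<delta> where "\<delta> > 0" and \<delta>: "\<And>I. finite I \<Longrightarrow> (\<forall>(u, v)\<in>I. a \<le> u \<and> u \<le> v \<and> v \<le> b) \<Longrightarrow>
       disjoint_family_on (\<lambda>(u, v). {u<..<v}) I \<Longrightarrow> (\<Sum>(u, v)\<in>I. v - u) < \<delta> \<Longrightarrow>
       (\<Sum>(u, v)\<in>I. norm (f v - f u)) < \<epsilon>"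
    by (rule abs_continuous_onE[OF assms(1) \<open>\<epsilon> > 0\<close>]) (rule that)
  show "\<exists>\<delta>>0. \<forall>I. finite I \<longrightarrow> (\<forall>(u, v)\<in>I. c \<le> u \<and> u \<le> v \<and> v \<le> d) \<longrightarrow>
       disjoint_family_on (\<lambda>(u, v). {u<..<v}) I \<longrightarrow> (\<Sum>(u, v)\<in>I. v - u) < \<delta> \<longrightarrow>
       (\<Sum>(u, v)\<in>I. norm (f v - f u)) < \<epsilon>"
  proof (intro exI[of _ \<delta>] conjI allI impI)
    fix I :: "(real \<times> real) set"
    assume I: "finite I" "\<forall>(u, v)\<in>I. c \<le> u \<and> u \<le> v \<and> v \<le> d"
      "disjoint_family_on (\<lambda>(u, v). {u<..<v}) I" "(\<Sum>(u, v)\<in>I. v - u) < \<delta>"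
    have "\<forall>(u, v)\<in>I. a \<le> u \<and> u \<le> v \<and> v \<le> b"
      using I(2) assms(2,3) by fastforce
    then show "(\<Sum>(u, v)\<in>I. norm (f v - f u)) < \<epsilon>"
      using \<delta> I by blast
  qed (rule \<open>\<delta> > 0\<close>)
qed

text \<open>Common source of the closure under bounded linear maps, sums and products, each of which
  reduces to a pointwise estimate of increments.\<close>

lemma abs_continuous_on_dominated:
  assumes f: "abs_continuous_on a b f" and g: "abs_continuous_on a b g" and "L \<ge> 0"
    and dom: "\<And>u v. \<lbrakk>u \<in> {a..b}; v \<in> {a..b}\<rbrakk> \<Longrightarrow>
      norm (h v - h u) \<le> L * (norm (f v - f u) + norm (g v - g u))"
  shows "abs_continuous_on a b h"
  unfolding abs_continuous_on_def
proof (intro allI impI)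
  fix \<epsilon> :: real assume "\<epsilon> > 0"
  \<comment> \<open>Dividing by \<open>L + 1\<close> rather than \<open>L\<close> covers
    \<open>L = 0\<close> and makes the final inequality strict.\<close>
  define \<epsilon>' where "\<epsilon>' = \<epsilon> / (L + 1) / 2"
  have "\<epsilon>' > 0" using \<open>\<epsilon> > 0\<close> \<open>L \<ge> 0\<close> by (simp add: \<epsilon>'_def)
  obtain \<delta>1 where "\<delta>1 > 0" and \<delta>1: "\<And>I. finite I \<Longrightarrow> (\<forall>(u, v)\<in>I. a \<le> u \<and> u \<le> v \<and> v \<le> b) \<Longrightarrow>
       disjoint_family_on (\<lambda>(u, v). {u<..<v}) I \<Longrightarrow> (\<Sum>(u, v)\<in>I. v - u) < \<delta>1 \<Longrightarrow>
       (\<Sum>(u, v)\<in>I. norm (f v - f u)) < \<epsilon>'"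
    by (rule abs_continuous_onE[OF f \<open>\<epsilon>' > 0\<close>]) (rule that)
  obtain \<delta>2 where "\<delta>2 > 0" and \<delta>2: "\<And>I. finite I \<Longrightarrow> (\<forall>(u, v)\<in>I. a \<le> u \<and> u \<le> v \<and> v \<le> b) \<Longrightarrow>
       disjoint_family_on (\<lambda>(u, v). {u<..<v}) I \<Longrightarrow> (\<Sum>(u, v)\<in>I. v - u) < \<delta>2 \<Longrightarrow>
       (\<Sum>(u, v)\<in>I. norm (g v - g u)) < \<epsilon>'"
    by (rule abs_continuous_onE[OF g \<open>\<epsilon>' > 0\<close>]) (rule that)
  have "(\<Sum>(u, v)\<in>I. norm (h v - h u)) < \<epsilon>"
    if I: "finite I" "\<forall>(u, v)\<in>I. a \<le> u \<and> u \<le> v \<and> v \<le> b"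
       "disjoint_family_on (\<lambda>(u, v). {u<..<v}) I" "(\<Sum>(u, v)\<in>I. v - u) < min \<delta>1 \<delta>2" for I
  proof -
    have "(\<Sum>(u, v)\<in>I. norm (h v - h u)) \<le> (\<Sum>(u, v)\<in>I. L * (norm (f v - f u) + norm (g v - g u)))"
      using I(2) by (intro sum_mono) (auto intro!: dom)
    also have "\<dots> = L * ((\<Sum>(u, v)\<in>I. norm (f v - f u)) + (\<Sum>(u, v)\<in>I. norm (g v - g u)))"
      by (simp add: sum_distrib_left sum.distrib[symmetric] case_prod_unfold)
    also have "\<dots> \<le> L * (\<epsilon>' + \<epsilon>')"
      using \<delta>1[OF I(1-3)] \<delta>2[OF I(1-3)] I(4) \<open>L \<ge> 0\<close> by (intro mult_left_mono) auto
    also have "\<epsilon>' + \<epsilon>' = \<epsilon> / (L + 1)" unfolding \<epsilon>'_def by (rule field_sum_of_halves)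
    also have "L * (\<epsilon> / (L + 1)) < \<epsilon>" using \<open>\<epsilon> > 0\<close> \<open>L \<ge> 0\<close> by (simp add: field_simps)
    finally show ?thesis .
  qed
  then show "\<exists>\<delta>>0. \<forall>I. finite I \<longrightarrow> (\<forall>(u, v)\<in>I. a \<le> u \<and> u \<le> v \<and> v \<le> b) \<longrightarrow>
       disjoint_family_on (\<lambda>(u, v). {u<..<v}) I \<longrightarrow> (\<Sum>(u, v)\<in>I. v - u) < \<delta> \<longrightarrow>
       (\<Sum>(u, v)\<in>I. norm (h v - h u)) < \<epsilon>"
    using \<open>\<delta>1 > 0\<close> \<open>\<delta>2 > 0\<close> by (intro exI[of _ "min \<delta>1 \<delta>2"]) simp
qed

lemma abs_continuous_on_bounded_linear:
  assumes f: "abs_continuous_on a b f" and "bounded_linear T"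
  shows "abs_continuous_on a b (\<lambda>x. T (f x))"
proof -
  interpret bounded_linear T by fact
  obtain K where K: "K \<ge> 0" "\<And>x. norm (T x) \<le> norm x * K" using nonneg_bounded by blast
  have "norm (T (f v) - T (f u)) \<le> K * (norm (f v - f u) + norm (f v - f u))" for u v
  proof -
    have "norm (T (f v) - T (f u)) \<le> K * norm (f v - f u)"
      using K(2)[of "f v - f u"] by (simp add: diff mult.commute)
    also have "\<dots> \<le> K * (norm (f v - f u) + norm (f v - f u))"
      using K(1) by (intro mult_left_mono) auto
    finally show ?thesis .
  qed
  then show ?thesis by (intro abs_continuous_on_dominated[OF f f K(1)])
qed

lemma abs_continuous_on_add:
  assumes "abs_continuous_on a b f" "abs_continuous_on a b g"
  shows "abs_continuous_on a b (\<lambda>x. f x + g x)"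
proof (rule abs_continuous_on_dominated[OF assms zero_le_one])
  show "norm (f v + g v - (f u + g u)) \<le> 1 * (norm (f v - f u) + norm (g v - g u))" for u v
    using norm_triangle_ineq[of "f v - f u" "g v - g u"] by (simp add: algebra_simps)
qed

lemma abs_continuous_on_imp_continuous_on:
  assumes "abs_continuous_on a b f"
  shows "continuous_on {a..b} f"
  unfolding continuous_on_iff
proof (intro ballI allI impI)
  fix x \<epsilon> :: real assume x: "x \<in> {a..b}" and "\<epsilon> > 0"
  obtain \<delta> where "\<delta> > 0" and \<delta>: "\<And>I. finite I \<Longrightarrow> (\<forall>(u, v)\<in>I. a \<le> u \<and> u \<le> v \<and> v \<le> b) \<Longrightarrow>
       disjoint_family_on (\<lambda>(u, v). {u<..<v}) I \<Longrightarrow> (\<Sum>(u, v)\<in>I. v - u) < \<delta> \<Longrightarrow>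
       (\<Sum>(u, v)\<in>I. norm (f v - f u)) < \<epsilon>"
    by (rule abs_continuous_onE[OF assms \<open>\<epsilon> > 0\<close>]) (rule that)
  have "dist (f y) (f x) < \<epsilon>" if "y \<in> {a..b}" "dist y x < \<delta>" for y
    using \<delta>[of "{(min x y, max x y)}"] x that
    by (cases "x \<le> y") (auto simp: disjoint_family_on_def dist_norm norm_minus_commute min_def max_def)
  then show "\<exists>d>0. \<forall>y\<in>{a..b}. dist y x < d \<longrightarrow> dist (f y) (f x) < \<epsilon>"
    using \<open>\<delta> > 0\<close> by blast
qed

text \<open>By the fundamental theorem \<open>f\<close> is an indefinite integral of
  \<open>g\<close>, and the indefinite integral of a continuous function is differentiable
  everywhere. This removes the exceptional null set of the differential equation whenever the
  right-hand side is continuous.\<close>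

lemma abs_continuous_on_has_vector_derivative:
  fixes f g :: "real \<Rightarrow> 'a::banach"
  assumes ac: "abs_continuous_on a b f" and N: "negligible N"
    and der: "\<And>x. x \<in> {a..b} - N \<Longrightarrow> (f has_vector_derivative g x) (at x)"
    and cont: "continuous_on {a..b} g" and x: "x \<in> {a..b}"
  shows "(f has_vector_derivative g x) (at x within {a..b})"
proof -
  have int: "(g has_integral f y - f a) {a..y}" if "y \<in> {a..b}" for y
    using that der
    by (intro abs_continuous_on_has_integral[OF abs_continuous_on_subinterval[OF ac] _ N])
       (auto intro: has_vector_derivative_at_within)
  have "((\<lambda>y. integral {a..y} g + f a) has_vector_derivative g x) (at x within {a..b})"
    using has_vector_derivative_add_const[THEN iffD2, OF integral_has_vector_derivative[OF cont x]] by simp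
  then show ?thesis
    by (rule has_vector_derivative_transform[OF x, rotated])
       (simp add: integral_unique[OF int])
qed

lemma abs_continuous_on_mult:
  fixes f g :: "real \<Rightarrow> 'a::real_normed_algebra"
  assumes f: "abs_continuous_on a b f" and g: "abs_continuous_on a b g"
  shows "abs_continuous_on a b (\<lambda>x. f x * g x)"
proof -
  have "bounded (f ` {a..b})" "bounded (g ` {a..b})"
    using f g by (auto intro!: compact_imp_bounded compact_continuous_image
      abs_continuous_on_imp_continuous_on)
  then obtain A B where A: "\<forall>y\<in>f ` {a..b}. norm y \<le> A" and B: "\<forall>y\<in>g ` {a..b}. norm y \<le> B"
    unfolding bounded_iff by blast
  \<comment> \<open>The maximum with 0 secures nonnegativity even if the interval is empty and the
    bounds \<open>A\<close> and \<open>B\<close> are arbitrary.\<close>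
  define L where "L = max 0 (max A B)"
  have L: "L \<ge> 0" "\<And>x. x \<in> {a..b} \<Longrightarrow> norm (f x) \<le> L" "\<And>x. x \<in> {a..b} \<Longrightarrow> norm (g x) \<le> L"
    using A B by (simp_all add: L_def le_max_iff_disj)
  show ?thesis
  proof (rule abs_continuous_on_dominated[OF f g L(1)])
    fix u v assume uv: "u \<in> {a..b}" "v \<in> {a..b}"
    have "f v * g v - f u * g u = (f v - f u) * g v + f u * (g v - g u)"
      by (simp add: algebra_simps)
    then have "norm (f v * g v - f u * g u) \<le> norm ((f v - f u) * g v) + norm (f u * (g v - g u))"
      by (simp add: norm_triangle_ineq)
    also have "\<dots> \<le> norm (f v - f u) * norm (g v) + norm (f u) * norm (g v - g u)"
      by (intro add_mono norm_mult_ineq)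
    also have "\<dots> \<le> norm (f v - f u) * L + L * norm (g v - g u)"
      using L uv by (intro add_mono mult_mono) auto
    finally show "norm (f v * g v - f u * g u) \<le> L * (norm (f v - f u) + norm (g v - g u))"
      by (simp add: algebra_simps)
  qed
qed

section \<open>Coupled growth and decay\<close>

text \<open>The coupling \<open>c\<close> cancels in \<open>U - W\<close>, leaving the derivative
  \<open>- 2 * \<alpha> * (U + W)\<close>, which is never positive. If it is negative at 0, the
  difference drops immediately to the right of 0 and cannot recover the loss.\<close>

lemma hyperbolic_pair_strict_decrease:
  fixes U W c :: "real \<Rightarrow> real"
  assumes "a > 0" "\<alpha> > 0"
    and nonneg: "\<And>x. x \<in> {0..a} \<Longrightarrow> U x \<ge> 0" "\<And>x. x \<in> {0..a} \<Longrightarrow> W x \<ge> 0"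
    and dU: "\<And>x. x \<in> {0..a} \<Longrightarrow> (U has_real_derivative - 2 * \<alpha> * U x + c x) (at x within {0..a})"
    and dW: "\<And>x. x \<in> {0..a} \<Longrightarrow> (W has_real_derivative 2 * \<alpha> * W x + c x) (at x within {0..a})"
  shows "x \<in> {0..a} \<Longrightarrow> U x - W x \<le> U 0 - W 0"
    and "U 0 + W 0 > 0 \<Longrightarrow> U a - W a < U 0 - W 0"
proof -
  define D where "D x = U x - W x" for x
  have dD: "(D has_real_derivative - 2 * \<alpha> * (U x + W x)) (at x within {0..a})" if "x \<in> {0..a}" for x
    unfolding D_def[abs_def]
    by (rule derivative_eq_intros dU dW that refl)+ (simp add: algebra_simps)
  have mono: "D y \<le> D x" if "0 \<le> x" "x \<le> y" "y \<le> a" for x y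
  proof (rule DERIV_nonpos_imp_decreasing_open[OF that(2)])
    fix z assume z: "x < z" "z < y"
    then have "at z within {0..a} = at z" using that by (intro at_within_Icc_at) auto
    then have "(D has_real_derivative - 2 * \<alpha> * (U z + W z)) (at z)"
      using dD[of z] z that by auto
    moreover have "- 2 * \<alpha> * (U z + W z) \<le> 0"
      using nonneg[of z] z that \<open>\<alpha> > 0\<close> by (simp add: mult_nonneg_nonneg)
    ultimately show "\<exists>l. (D has_real_derivative l) (at z) \<and> l \<le> 0" by blast
  next
    have "continuous_on {0..a} D"
      using dD by (intro DERIV_continuous_on) blast
    then show "continuous_on {x..y} D"
      by (rule continuous_on_subset) (use that in auto)
  qed
  show "U x - W x \<le> U 0 - W 0" if "x \<in> {0..a}"
    using mono[of 0 x] that by (simp add: D_def)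
  show "U a - W a < U 0 - W 0" if pos: "U 0 + W 0 > 0"
  proof -
    have "- 2 * \<alpha> * (U 0 + W 0) < 0" using pos \<open>\<alpha> > 0\<close> by (simp add: mult_pos_pos)
    then obtain d where "d > 0" and d: "\<And>h. \<lbrakk>h > 0; 0 + h \<in> {0..a}; h < d\<rbrakk> \<Longrightarrow> D (0 + h) < D 0"
      using has_real_derivative_neg_dec_right[OF dD[of 0]] \<open>a > 0\<close> by auto
    define h where "h = min a (d / 2)"
    have "0 < h" "h \<le> a" "h < d" using \<open>d > 0\<close> \<open>a > 0\<close> by (auto simp: h_def)
    then have "D h < D 0" "D a \<le> D h" using d[of h] mono[of h a] by auto
    then show ?thesis by (simp add: D_def)
  qed
qed

text \<open>The quotient of the components is periodic and satisfies a Riccati type inequality whose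
  right-hand side is negative above the asserted bound, so the bound holds at the maximum.\<close>

lemma hyperbolic_pair_quotient_bound:
  fixes U W c :: "real \<Rightarrow> real"
  assumes "a > 0" "\<alpha> > 0" "m \<ge> 0"
    and nonneg: "\<And>x. x \<in> {0..a} \<Longrightarrow> U x \<ge> 0"
    and less: "\<And>x. x \<in> {0..a} \<Longrightarrow> U x < W x"
    and c: "\<And>x. x \<in> {0..a} \<Longrightarrow> \<bar>c x\<bar> \<le> 2 * m * (sqrt (U x) * sqrt (W x))"
    and dU: "\<And>x. x \<in> {0..a} \<Longrightarrow> (U has_real_derivative - 2 * \<alpha> * U x + c x) (at x within {0..a})"
    and dW: "\<And>x. x \<in> {0..a} \<Longrightarrow> (W has_real_derivative 2 * \<alpha> * W x + c x) (at x within {0..a})"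
    and per: "U a / W a = U 0 / W 0"
    and x: "x \<in> {0..a}"
  shows "sqrt (U x) \<le> m / (2 * \<alpha>) * sqrt (W x)"
proof -
  define s where "s x = U x / W x" for x
  have W: "W x > 0" if "x \<in> {0..a}" for x using nonneg[OF that] less[OF that] by simp
  \<comment> \<open>The quotient rule cancels both denominators down to one: the linear terms
    combine to rate \<open>4 * \<alpha>\<close>, and the coupling enters with the factor
    \<open>1 - s\<close>, which lies between 0 and 1.\<close>
  have ds: "(s has_real_derivative - 4 * \<alpha> * s x + c x / W x * (1 - s x)) (at x within {0..a})"
    if "x \<in> {0..a}" for x
  proof -
    have "(s has_real_derivative ((- 2 * \<alpha> * U x + c x) * W x - U x * (2 * \<alpha> * W x + c x)) / (W x * W x))
       (at x within {0..a})"
      unfolding s_def[abs_def] using W[OF that] dU[OF that] dW[OF that] by (intro DERIV_divide) auto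
    moreover have "((- 2 * \<alpha> * U x + c x) * W x - U x * (2 * \<alpha> * W x + c x)) / (W x * W x)
        = - 4 * \<alpha> * s x + c x / W x * (1 - s x)"
      using W[OF that] by (simp add: s_def field_simps)
    ultimately show ?thesis by simp
  qed
  have "continuous_on {0..a} s" using ds by (intro DERIV_continuous_on) blast
  then obtain x1 where x1: "x1 \<in> {0..a}" "\<And>x. x \<in> {0..a} \<Longrightarrow> s x \<le> s x1"
    using continuous_attains_sup[of "{0..a}" s] \<open>a > 0\<close> by auto
  \<comment> \<open>The contradiction will come from points to the left of the maximum. By
    periodicity a maximum at 0 is also attained at \<open>a\<close>, so the maximum point may be
    taken positive.\<close>
  define x0 where "x0 = (if x1 = 0 then a else x1)"
  have x0: "0 < x0" "x0 \<in> {0..a}" "\<And>x. x \<in> {0..a} \<Longrightarrow> s x \<le> s x0"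
    using x1 per \<open>a > 0\<close> by (auto simp: x0_def s_def)
  define t where "t = sqrt (s x0)"
  have s0: "s x0 \<ge> 0" "s x0 \<le> 1" using nonneg[OF x0(2)] less[OF x0(2)] W[OF x0(2)] by (auto simp: s_def)
  have t: "t \<ge> 0" "t\<^sup>2 = s x0" using s0 by (auto simp: t_def)
  have "t \<le> m / (2 * \<alpha>)"
  proof (rule ccontr)
    assume "\<not> t \<le> m / (2 * \<alpha>)"
    \<comment> \<open>At \<open>t = m / (2 * \<alpha>)\<close> the coupling bound
      \<open>2 * m * t\<close> and the damping \<open>4 * \<alpha> * t\<^sup>2\<close> balance;
      above it the damping wins.\<close>
    then have big: "t > m / (2 * \<alpha>)" by simp
    then have "2 * m < 4 * \<alpha> * t" using \<open>\<alpha> > 0\<close> by (simp add: field_simps)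
    have "t > 0" using big \<open>\<alpha> > 0\<close> \<open>m \<ge> 0\<close> divide_nonneg_pos[of m "2 * \<alpha>"] by linarith
    have "c x0 / W x0 \<le> 2 * m * t"
    proof -
      have "c x0 / W x0 \<le> 2 * m * (sqrt (U x0) * sqrt (W x0)) / W x0"
        using c[OF x0(2)] W[OF x0(2)] by (intro divide_right_mono) auto
      also have "\<dots> = 2 * m * (sqrt (U x0) * (sqrt (W x0) / W x0))" by simp
      also have "sqrt (W x0) / W x0 = 1 / sqrt (W x0)"
        using W[OF x0(2)] by (simp add: field_simps)
      finally show ?thesis by (simp add: t_def s_def real_sqrt_divide)
    qed
    then have "c x0 / W x0 * (1 - s x0) \<le> 2 * m * t * (1 - s x0)"
      using s0 by (intro mult_right_mono) auto
    also have "\<dots> \<le> 2 * m * t" using s0 t \<open>m \<ge> 0\<close> by (intro mult_left_le) auto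
    also have "\<dots> < 4 * \<alpha> * t * t"
      using \<open>2 * m < _\<close> \<open>t > 0\<close> by (intro mult_strict_right_mono) auto
    also have "\<dots> = 4 * \<alpha> * s x0" using t by (simp add: power2_eq_square)
    finally have "- 4 * \<alpha> * s x0 + c x0 / W x0 * (1 - s x0) < 0" by simp
    \<comment> \<open>A negative derivative at \<open>x0\<close> makes \<open>s\<close> larger
      slightly to the left, contradicting maximality.\<close>
    then obtain d where "d > 0" and d: "\<And>h. \<lbrakk>h > 0; x0 - h \<in> {0..a}; h < d\<rbrakk> \<Longrightarrow> s x0 < s (x0 - h)"
      using has_real_derivative_neg_dec_left[OF ds[OF x0(2)]] by auto
    define h where "h = min x0 (d / 2)"
    have "0 < h" "x0 - h \<in> {0..a}" "h < d" using \<open>d > 0\<close> x0 by (auto simp: h_def)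
    then show False using d[of h] x0(3)[of "x0 - h"] by auto
  qed
  moreover have "sqrt (s x) \<le> t" using x0(3)[OF x] by (simp add: t_def)
  ultimately have "sqrt (U x) / sqrt (W x) \<le> m / (2 * \<alpha>)" by (simp add: s_def real_sqrt_divide)
  then show ?thesis using W[OF x] by (simp add: divide_le_eq)
qed

text \<open>Over one period \<open>U - W\<close> strictly decreases and is also multiplied by a
  factor at least 1. Hence it is negative at 0 and, being decreasing, throughout, which makes the
  quotient bound applicable. The logarithm of \<open>U + W\<close> then grows at a nearly constant
  rate, which periodicity compares with \<open>2 * \<kappa>\<close>.\<close>

lemma hyperbolic_pair_growth:
  fixes U W c :: "real \<Rightarrow> real"
  assumes "a > 0" "\<alpha> > 0" "m \<ge> 0" "\<kappa> \<ge> 0"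
    and nonneg: "\<And>x. x \<in> {0..a} \<Longrightarrow> U x \<ge> 0" "\<And>x. x \<in> {0..a} \<Longrightarrow> W x \<ge> 0"
    and c: "\<And>x. x \<in> {0..a} \<Longrightarrow> \<bar>c x\<bar> \<le> 2 * m * (sqrt (U x) * sqrt (W x))"
    and dU: "\<And>x. x \<in> {0..a} \<Longrightarrow> (U has_real_derivative - 2 * \<alpha> * U x + c x) (at x within {0..a})"
    and dW: "\<And>x. x \<in> {0..a} \<Longrightarrow> (W has_real_derivative 2 * \<alpha> * W x + c x) (at x within {0..a})"
    and per: "U a = exp (2 * \<kappa> * a) * U 0" "W a = exp (2 * \<kappa> * a) * W 0"
    and pos: "U 0 + W 0 > 0"
    and x: "x \<in> {0..a}"
  shows "U x + W x > 0" and "\<bar>ln ((U x + W x) / (U 0 + W 0)) - 2 * \<kappa> * x\<bar> \<le> 6 * m\<^sup>2 * a / \<alpha>"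
proof -
  define R where "R = exp (2 * \<kappa> * a)"
  have R: "R \<ge> 1" using \<open>a > 0\<close> \<open>\<kappa> \<ge> 0\<close> by (simp add: R_def)
  have "U a - W a < U 0 - W 0"
    by (rule hyperbolic_pair_strict_decrease(2)[OF assms(1,2) nonneg dU dW pos])
  moreover have "U a - W a = R * (U 0 - W 0)" using per by (simp add: R_def algebra_simps)
  moreover have "U 0 - W 0 \<le> R * (U 0 - W 0)" if "U 0 - W 0 \<ge> 0"
    using mult_right_mono[OF R that] by simp
  ultimately have D0: "U 0 - W 0 < 0" by linarith
  have less: "U y < W y" if "y \<in> {0..a}" for y
    using hyperbolic_pair_strict_decrease(1)[OF assms(1,2) nonneg dU dW that] D0 by simp
  have pr: "U a / W a = U 0 / W 0" using per by simp
  have quot: "sqrt (U y) \<le> m / (2 * \<alpha>) * sqrt (W y)" if "y \<in> {0..a}" for y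
    by (rule hyperbolic_pair_quotient_bound[OF assms(1-3) nonneg(1) less c dU dW pr that])
  define N where "N y = U y + W y" for y
  have N: "N y > 0" if "y \<in> {0..a}" for y using less[OF that] nonneg(1)[OF that] by (simp add: N_def)
  then show "U x + W x > 0" using x by (simp add: N_def)
  \<comment> \<open>By the quotient bound, \<open>4 * \<alpha> * U\<close> is at most
    \<open>m\<^sup>2 / \<alpha> * W\<close> and \<open>2 * \<bar>c\<bar>\<close> at most
    \<open>2 * m\<^sup>2 / \<alpha> * W\<close>; together they give the factor 3.\<close>
  define K where "K = 3 * m\<^sup>2 / \<alpha>"
  \<comment> \<open>Subtracting the leading growth \<open>2 * \<alpha> * y\<close> leaves a function
    with derivative bounded by \<open>K\<close>.\<close>
  define G where "G y = ln (N y) - 2 * \<alpha> * y" for y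
  have dG: "(G has_real_derivative (- 4 * \<alpha> * U y + 2 * c y) / N y) (at y within {0..a})"
    if "y \<in> {0..a}" for y
  proof -
    have "(N has_real_derivative - 2 * \<alpha> * U y + 2 * \<alpha> * W y + 2 * c y) (at y within {0..a})"
      unfolding N_def[abs_def] using DERIV_add[OF dU[OF that] dW[OF that]] by (simp add: algebra_simps)
    then have "(G has_real_derivative (- 2 * \<alpha> * U y + 2 * \<alpha> * W y + 2 * c y) / N y - 2 * \<alpha>) (at y within {0..a})"
      unfolding G_def[abs_def] using N[OF that]
      by (auto intro!: derivative_eq_intros simp: divide_inverse mult.commute)
    moreover have "(- 2 * \<alpha> * U y + 2 * \<alpha> * W y + 2 * c y) / N y - 2 * \<alpha> = (- 4 * \<alpha> * U y + 2 * c y) / N y"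
      using N[OF that] by (simp add: field_simps) (simp add: N_def algebra_simps)
    ultimately show ?thesis by simp
  qed
  have bG: "norm ((- 4 * \<alpha> * U y + 2 * c y) / N y) \<le> K" if y: "y \<in> {0..a}" for y
  proof -
    define p q where "p = sqrt (U y)" and "q = sqrt (W y)"
    have pq: "p \<ge> 0" "q \<ge> 0" "U y = p\<^sup>2" "W y = q\<^sup>2" "p \<le> m / (2 * \<alpha>) * q"
      using nonneg[OF y] quot[OF y] by (auto simp: p_def q_def)
    have cy: "\<bar>c y\<bar> \<le> 2 * m * (p * q)" using c[OF y] by (simp add: p_def q_def)
    have "p\<^sup>2 \<le> (m / (2 * \<alpha>) * q)\<^sup>2" using pq by (intro power_mono) auto
    then have "4 * \<alpha> * p\<^sup>2 \<le> 4 * \<alpha> * (m / (2 * \<alpha>) * q)\<^sup>2"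
      using \<open>\<alpha> > 0\<close> by (intro mult_left_mono) auto
    also have "\<dots> = m\<^sup>2 / \<alpha> * q\<^sup>2" using \<open>\<alpha> > 0\<close> by (simp add: power2_eq_square field_simps)
    finally have 1: "4 * \<alpha> * U y \<le> m\<^sup>2 / \<alpha> * q\<^sup>2" using pq by simp
    have "p * q \<le> m / (2 * \<alpha>) * q * q" using pq by (intro mult_right_mono) auto
    then have "4 * m * (p * q) \<le> 4 * m * (m / (2 * \<alpha>) * q * q)"
      using \<open>m \<ge> 0\<close> by (intro mult_left_mono) auto
    also have "\<dots> = 2 * m\<^sup>2 / \<alpha> * q\<^sup>2" using \<open>\<alpha> > 0\<close> by (simp add: power2_eq_square field_simps)
    finally have 2: "2 * \<bar>c y\<bar> \<le> 2 * m\<^sup>2 / \<alpha> * q\<^sup>2" using cy by simp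
    have "\<bar>- 4 * \<alpha> * U y + 2 * c y\<bar> \<le> 4 * \<alpha> * U y + 2 * \<bar>c y\<bar>"
      using nonneg(1)[OF y] \<open>\<alpha> > 0\<close> abs_triangle_ineq[of "- 4 * \<alpha> * U y" "2 * c y"]
      by (simp add: abs_mult)
    also have "\<dots> \<le> K * q\<^sup>2" using 1 2 by (simp add: K_def algebra_simps add_divide_distrib)
    also have "\<dots> \<le> K * N y" using pq \<open>\<alpha> > 0\<close> by (intro mult_left_mono) (auto simp: N_def K_def)
    finally show ?thesis using N[OF y] by (simp add: divide_le_eq)
  qed
  have GG: "\<bar>G y - G 0\<bar> \<le> K * y" if "y \<in> {0..a}" for y
    using field_differentiable_bound[of "{0..a}" G _ K y 0, OF _ dG bG] that \<open>a > 0\<close> by simp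
  have lnN: "ln (N y / N 0) = G y - G 0 + 2 * \<alpha> * y" if "y \<in> {0..a}" for y
    using N[OF that] N[of 0] \<open>a > 0\<close> by (simp add: G_def ln_div)
  \<comment> \<open>Evaluation over the full period identifies \<open>\<kappa>\<close> with
    \<open>\<alpha>\<close> up to \<open>K / 2\<close>, so the unknown exponent
    \<open>\<kappa>\<close> can replace \<open>\<alpha>\<close> below.\<close>
  have "N a = R * N 0" using per by (simp add: N_def R_def algebra_simps)
  then have "ln (N a / N 0) = 2 * \<kappa> * a" using N[of 0] \<open>a > 0\<close> by (simp add: R_def)
  then have "\<bar>2 * \<kappa> - 2 * \<alpha>\<bar> * a \<le> K * a"
    using GG[of a] lnN[of a] \<open>a > 0\<close> by (simp add: abs_mult_pos' algebra_simps)
  then have ka: "\<bar>2 * \<kappa> - 2 * \<alpha>\<bar> \<le> K" using \<open>a > 0\<close> by simp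
  \<comment> \<open>Two errors of size \<open>K * a\<close> add up: the deviation of
    \<open>G\<close>, and the exchange of \<open>\<alpha>\<close> for \<open>\<kappa>\<close>. This
    turns the factor 3 into 6.\<close>
  have "\<bar>ln (N x / N 0) - 2 * \<kappa> * x\<bar> = \<bar>(G x - G 0) - (2 * \<kappa> - 2 * \<alpha>) * x\<bar>"
    using lnN[OF x] by (simp add: algebra_simps)
  also have "\<dots> \<le> \<bar>G x - G 0\<bar> + \<bar>2 * \<kappa> - 2 * \<alpha>\<bar> * x"
    using abs_triangle_ineq4[of "G x - G 0" "(2 * \<kappa> - 2 * \<alpha>) * x"] x by (simp add: abs_mult)
  also have "\<dots> \<le> K * x + K * x" using GG[OF x] ka x by (intro add_mono mult_right_mono) auto
  also have "\<dots> \<le> K * a + K * a" using x \<open>\<alpha> > 0\<close> by (intro add_mono mult_left_mono) (auto simp: K_def)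
  also have "\<dots> = 6 * m\<^sup>2 * a / \<alpha>" by (simp add: K_def)
  finally show "\<bar>ln ((U x + W x) / (U 0 + W 0)) - 2 * \<kappa> * x\<bar> \<le> 6 * m\<^sup>2 * a / \<alpha>"
    by (simp add: N_def)
qed

text \<open>The reflection of the interval reverses the sign of every derivative. Exchanging
  \<open>U\<close> with \<open>W\<close> and negating \<open>c\<close> restores the same system,
  while the multiplier becomes its inverse and decay becomes growth.\<close>

lemma hyperbolic_pair_decay:
  fixes U W c :: "real \<Rightarrow> real"
  assumes "a > 0" "\<alpha> > 0" "m \<ge> 0" "\<kappa> \<ge> 0"
    and nonneg: "\<And>x. x \<in> {0..a} \<Longrightarrow> U x \<ge> 0" "\<And>x. x \<in> {0..a} \<Longrightarrow> W x \<ge> 0"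
    and c: "\<And>x. x \<in> {0..a} \<Longrightarrow> \<bar>c x\<bar> \<le> 2 * m * (sqrt (U x) * sqrt (W x))"
    and dU: "\<And>x. x \<in> {0..a} \<Longrightarrow> (U has_real_derivative - 2 * \<alpha> * U x + c x) (at x within {0..a})"
    and dW: "\<And>x. x \<in> {0..a} \<Longrightarrow> (W has_real_derivative 2 * \<alpha> * W x + c x) (at x within {0..a})"
    and per: "U a = exp (- 2 * \<kappa> * a) * U 0" "W a = exp (- 2 * \<kappa> * a) * W 0"
    and pos: "U 0 + W 0 > 0"
    and x: "x \<in> {0..a}"
  shows "U x + W x > 0" and "\<bar>ln ((U x + W x) / (U 0 + W 0)) + 2 * \<kappa> * x\<bar> \<le> 6 * m\<^sup>2 * a / \<alpha>"
proof -
  define U' W' c' where "U' y = W (a - y)" and "W' y = U (a - y)" and "c' y = - c (a - y)" for y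
  have refl: "((\<lambda>y. f (a - y)) has_real_derivative - l) (at y within {0..a})"
    if "(f has_real_derivative l) (at (a - y) within {0..a})" for f l y
  proof -
    have "(f has_real_derivative l) (at (a - y) within (\<lambda>y. a - y) ` {0..a})"
      using that by simp
    then have "((\<lambda>y. f (a - y)) has_real_derivative l * (- 1)) (at y within {0..a})"
      by (rule DERIV_image_chain[of f _ "\<lambda>y. a - y", unfolded o_def]) (auto intro!: derivative_eq_intros)
    then show ?thesis by simp
  qed
  have N: "U a + W a = exp (- 2 * \<kappa> * a) * (U 0 + W 0)" using per by (simp add: algebra_simps)
  have p: "U' y \<ge> 0" "W' y \<ge> 0" "\<bar>c' y\<bar> \<le> 2 * m * (sqrt (U' y) * sqrt (W' y))"
    "(U' has_real_derivative - 2 * \<alpha> * U' y + c' y) (at y within {0..a})"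
    "(W' has_real_derivative 2 * \<alpha> * W' y + c' y) (at y within {0..a})" if "y \<in> {0..a}" for y
  proof -
    have y: "a - y \<in> {0..a}" using that by auto
    show "U' y \<ge> 0" "W' y \<ge> 0" "\<bar>c' y\<bar> \<le> 2 * m * (sqrt (U' y) * sqrt (W' y))"
      using nonneg[OF y] c[OF y] by (auto simp: U'_def W'_def c'_def mult.commute)
    show "(U' has_real_derivative - 2 * \<alpha> * U' y + c' y) (at y within {0..a})"
      "(W' has_real_derivative 2 * \<alpha> * W' y + c' y) (at y within {0..a})"
      using refl[OF dU[OF y]] refl[OF dW[OF y]] unfolding U'_def[abs_def] W'_def[abs_def] c'_def[abs_def] by simp_all
  qed
  have per': "U' a = exp (2 * \<kappa> * a) * U' 0" "W' a = exp (2 * \<kappa> * a) * W' 0"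
    using per by (simp_all add: U'_def W'_def exp_minus)
  have pos': "U' 0 + W' 0 > 0" using N pos by (simp add: U'_def W'_def add.commute)
  have x': "a - x \<in> {0..a}" using x by auto
  note g = hyperbolic_pair_growth[OF assms(1-4) p per' pos' x']
  show Nx: "U x + W x > 0" using g(1) by (simp add: U'_def W'_def)
  \<comment> \<open>The reflected estimate is normalised at the right endpoint. Returning to the
    value at 0 costs the factor \<open>exp (2 * \<kappa> * a)\<close>, which combines with the
    exponent \<open>2 * \<kappa> * (a - x)\<close> to leave only
    \<open>2 * \<kappa> * x\<close>.\<close>
  have "(U' (a - x) + W' (a - x)) / (U' 0 + W' 0) = exp (2 * \<kappa> * a) * ((U x + W x) / (U 0 + W 0))"
  proof -
    have "U' 0 + W' 0 = (U 0 + W 0) / exp (2 * \<kappa> * a)"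
      using N by (simp add: U'_def W'_def add.commute exp_minus divide_inverse mult.commute)
    then show ?thesis by (simp add: U'_def W'_def add.commute mult.commute)
  qed
  also have "ln \<dots> = 2 * \<kappa> * a + ln ((U x + W x) / (U 0 + W 0))"
    using Nx pos by (subst ln_mult) auto
  finally show "\<bar>ln ((U x + W x) / (U 0 + W 0)) + 2 * \<kappa> * x\<bar> \<le> 6 * m\<^sup>2 * a / \<alpha>"
    using g(2) by (simp add: algebra_simps)
qed

section \<open>The Dirac equation\<close>

lemma abs_exp_minus_one_le:
  fixes t b :: real
  assumes "\<bar>t\<bar> \<le> b" "b \<le> 1"
  shows "\<bar>exp t - 1\<bar> \<le> 2 * b"
proof (cases "t \<ge> 0")
  case True
  then have "exp t \<le> 1 + t + t\<^sup>2" using assms by (intro exp_bound) auto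
  moreover have "t\<^sup>2 \<le> t" using True assms by (simp add: power2_eq_square mult_left_le)
  ultimately show ?thesis using True assms by simp
next
  case False
  then have "exp t < 1" by simp
  then show ?thesis using assms exp_ge_add_one_self[of t] by linarith
qed

text \<open>Exponentiating the logarithmic bound controls the relative deviation \<open>r\<close> of
  the norm from its value at 0. The identity for \<open>r\<close> is exact for every positive
  \<open>\<alpha>\<close>; only the estimate of its size requires large
  \<open>\<alpha>\<close>.\<close>

lemma phi_asymptotics_of_log_bound:
  fixes \<phi> :: "real \<Rightarrow> complex \<Rightarrow> complex^2"
  assumes "a > 0" "L \<ge> 0"
    and pos: "\<And>x \<alpha>. \<lbrakk>\<alpha> > 0; x \<in> {0..a}\<rbrakk> \<Longrightarrow> norm (\<phi> x (Complex \<mu> \<alpha>)) > 0"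
    and bound: "\<And>x \<alpha>. \<lbrakk>\<alpha> > 0; x \<in> {0..a}\<rbrakk> \<Longrightarrow>
       \<bar>ln (norm (\<phi> x (Complex \<mu> \<alpha>)) / norm (\<phi> 0 (Complex \<mu> \<alpha>)))\<bar> \<le> L / \<alpha>"
  shows "\<exists>r. unif_bigo a r (\<lambda>\<alpha>. 1 / \<alpha>) \<and>
               (\<forall>\<alpha>>0. \<forall>x\<in>{0..a}. norm (\<phi> x (Complex \<mu> \<alpha>))
                  = norm (\<phi> 0 (Complex \<mu> \<alpha>)) * (1 + r x \<alpha>))"
    and "(\<lambda>\<alpha>. gamma_quot a \<phi> (Complex \<mu> \<alpha>) - 1) \<in> O[at_top](\<lambda>\<alpha>. 1 / \<alpha>)"
proof -
  define p where "p x \<alpha> = norm (\<phi> x (Complex \<mu> \<alpha>))" for x \<alpha>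
  define r where "r x \<alpha> = p x \<alpha> / p 0 \<alpha> - 1" for x \<alpha>
  have p: "p x \<alpha> > 0" if "\<alpha> > 0" "x \<in> {0..a}" for x \<alpha> using pos[OF that] by (simp add: p_def)
  have p0: "p 0 \<alpha> > 0" if "\<alpha> > 0" for \<alpha> using p[OF that, of 0] \<open>a > 0\<close> by simp
  have pr: "p x \<alpha> = p 0 \<alpha> * (1 + r x \<alpha>)" if "\<alpha> > 0" for x \<alpha>
    using p0[OF that] by (simp add: r_def)
  \<comment> \<open>The threshold makes \<open>L / \<alpha>\<close> at most 1, where the exponential
    can be linearised with constant 2, and keeps \<open>\<alpha>\<close> positive.\<close>
  have r: "\<bar>r x \<alpha>\<bar> \<le> 2 * L / \<alpha>" if "\<alpha> \<ge> max 1 L" "x \<in> {0..a}" for x \<alpha>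
  proof -
    have \<alpha>: "\<alpha> > 0" using that(1) by simp
    have "r x \<alpha> = exp (ln (p x \<alpha> / p 0 \<alpha>)) - 1" using p[OF \<alpha> that(2)] p0[OF \<alpha>] by (simp add: r_def)
    moreover have "\<bar>exp (ln (p x \<alpha> / p 0 \<alpha>)) - 1\<bar> \<le> 2 * (L / \<alpha>)"
      using bound[OF \<alpha> that(2)] that \<alpha> by (intro abs_exp_minus_one_le) (auto simp: p_def divide_le_eq)
    ultimately show ?thesis by simp
  qed
  have ev: "eventually (\<lambda>\<alpha>. \<alpha> \<ge> max 1 L) at_top" by (rule eventually_ge_at_top)
  have "unif_bigo a r (\<lambda>\<alpha>. 1 / \<alpha>)"
    unfolding unif_bigo_def
    by (intro exI[of _ "2 * L"] eventually_mono[OF ev]) (use r in auto)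
  then show "\<exists>r. unif_bigo a r (\<lambda>\<alpha>. 1 / \<alpha>) \<and>
               (\<forall>\<alpha>>0. \<forall>x\<in>{0..a}. norm (\<phi> x (Complex \<mu> \<alpha>))
                  = norm (\<phi> 0 (Complex \<mu> \<alpha>)) * (1 + r x \<alpha>))"
    using pr unfolding p_def by blast
  have "norm (gamma_quot a \<phi> (Complex \<mu> \<alpha>) - 1) \<le> 2 * L * norm (1 / \<alpha>)" if \<alpha>1: "\<alpha> \<ge> max 1 L" for \<alpha>
  proof -
    have \<alpha>: "\<alpha> > 0" using \<alpha>1 by simp
    \<comment> \<open>The supremum is squeezed between \<open>p 0 \<alpha>\<close>, as 0 lies in the
      interval, and \<open>p 0 \<alpha> * (1 + 2 * L / \<alpha>)\<close>. Dividing the gap by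
      \<open>S\<close> does not enlarge the relative error, since \<open>p 0 \<alpha> / S\<close> is
      at most 1.\<close>
    define S where "S = (SUP x\<in>{0..a}. p x \<alpha>)"
    have le: "p x \<alpha> \<le> p 0 \<alpha> * (1 + 2 * L / \<alpha>)" if "x \<in> {0..a}" for x
      using r[OF \<alpha>1 that] p0[OF \<alpha>] unfolding pr[OF \<alpha>, of x] by (intro mult_left_mono) auto
    have "S \<le> p 0 \<alpha> * (1 + 2 * L / \<alpha>)"
      unfolding S_def using le \<open>a > 0\<close> by (intro cSUP_least) auto
    moreover have S0: "p 0 \<alpha> \<le> S"
      unfolding S_def using le \<open>a > 0\<close> by (intro cSUP_upper bdd_aboveI2) auto
    ultimately have S: "S - p 0 \<alpha> \<le> 2 * L / \<alpha> * p 0 \<alpha>" "S > 0"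
      using p0[OF \<alpha>] by (auto simp: algebra_simps)
    have "\<bar>p 0 \<alpha> / S - 1\<bar> = (S - p 0 \<alpha>) / S" using S S0 by (simp add: field_simps)
    also have "\<dots> \<le> 2 * L / \<alpha> * p 0 \<alpha> / S" using S by (intro divide_right_mono) auto
    also have "\<dots> = 2 * L / \<alpha> * (p 0 \<alpha> / S)" by simp
    also have "\<dots> \<le> 2 * L / \<alpha> * 1" using S S0 \<alpha> \<open>L \<ge> 0\<close> by (intro mult_left_mono) auto
    finally show ?thesis using \<alpha> by (simp add: gamma_quot_def S_def p_def)
  qed
  then show "(\<lambda>\<alpha>. gamma_quot a \<phi> (Complex \<mu> \<alpha>) - 1) \<in> O[at_top](\<lambda>\<alpha>. 1 / \<alpha>)"
    by (intro bigoI[of _ "2 * L"] eventually_mono[OF ev])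
qed

section \<open>The Dirac system in components and in chiral coordinates\<close>

lemma dirac_solution_entries:
  assumes sol: "dirac_solution m q z Y"
  obtains N where "negligible N"
    and "\<And>x. x \<notin> N \<Longrightarrow> \<exists>Y'. (Y has_vector_derivative Y') (at x) \<and>
       (\<forall>j. Y' $ 1 $ j = (z - of_real (q x) + of_real m) * Y x $ 2 $ j \<and>
            Y' $ 2 $ j = - (z - of_real (q x) - of_real m) * Y x $ 1 $ j)"
proof -
  have ae: "AE x in lebesgue. \<exists>Y'. (Y has_vector_derivative Y') (at x) \<and>
       mat (- \<i>) ** sigma2 ** Y'
         + (mat (of_real m) ** sigma3 + mat (of_real (q x))) ** Y x = mat z ** Y x"
    using sol by (simp add: dirac_solution_def)
  then obtain N where N: "N \<in> null_sets lebesgue"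
    and sub: "{x \<in> space lebesgue. \<not> (\<exists>Y'. (Y has_vector_derivative Y') (at x) \<and>
       mat (- \<i>) ** sigma2 ** Y'
         + (mat (of_real m) ** sigma3 + mat (of_real (q x))) ** Y x = mat z ** Y x)} \<subseteq> N"
    unfolding eventually_ae_filter by blast
  show ?thesis
  proof (rule that)
    show "negligible N" using N by (simp add: negligible_iff_null_sets)
    fix x assume "x \<notin> N"
    then obtain Y' where Y': "(Y has_vector_derivative Y') (at x)"
      and eq: "mat (- \<i>) ** sigma2 ** Y'
         + (mat (of_real m) ** sigma3 + mat (of_real (q x))) ** Y x = mat z ** Y x"
      using sub by auto
    have "Y' $ 1 $ j = (z - of_real (q x) + of_real m) * Y x $ 2 $ j \<and>
            Y' $ 2 $ j = - (z - of_real (q x) - of_real m) * Y x $ 1 $ j" for j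
    proof -
      have e: "(mat (- \<i>) ** sigma2 ** Y'
         + (mat (of_real m) ** sigma3 + mat (of_real (q x))) ** Y x) $ i $ j = (mat z ** Y x) $ i $ j" for i
        by (simp add: eq)
      \<comment> \<open>The leading coefficient is the real matrix with rows (0, -1) and (1, 0).
        Thus the first row of the equation determines the derivative of the second component, and
        the second row that of the first.\<close>
      have "- (Y' $ 2 $ j) + (of_real m + of_real (q x)) * Y x $ 1 $ j = z * Y x $ 1 $ j"
        using e[of 1] by (simp add: matrix_matrix_mult_def mat_def sigma2_def sigma3_def sum_2)
      moreover have "Y' $ 1 $ j + (of_real (q x) - of_real m) * Y x $ 2 $ j = z * Y x $ 2 $ j"
        using e[of 2] by (simp add: matrix_matrix_mult_def mat_def sigma2_def sigma3_def sum_2)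
      ultimately show ?thesis by (auto simp: algebra_simps)
    qed
    then show "\<exists>Y'. (Y has_vector_derivative Y') (at x) \<and>
       (\<forall>j. Y' $ 1 $ j = (z - of_real (q x) + of_real m) * Y x $ 2 $ j \<and>
            Y' $ 2 $ j = - (z - of_real (q x) - of_real m) * Y x $ 1 $ j)"
      using Y' by blast
  qed
qed

lemma bounded_linear_entry: "bounded_linear (\<lambda>A::complex^'n^'m. A $ i $ j)"
  by (rule bounded_linear_compose[OF bounded_linear_vec_nth bounded_linear_vec_nth])

text \<open>Liouville's formula: the coefficient matrix of the first-order system has trace zero, so
  the determinant has derivative 0 almost everywhere, and absolute continuity makes its increment
  vanish.\<close>

lemma dirac_solution_det:
  assumes sol: "dirac_solution m q z Y" and "a \<ge> 0"
  shows "det (Y a) = det (Y 0)"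
proof -
  have ac: "abs_continuous_on 0 a Y"
    using sol by (simp add: dirac_solution_def locally_abs_continuous_def)
  note acE = abs_continuous_on_bounded_linear[OF ac bounded_linear_entry]
  obtain N where N: "negligible N"
    and der: "\<And>x. x \<notin> N \<Longrightarrow> \<exists>Y'. (Y has_vector_derivative Y') (at x) \<and>
       (\<forall>j. Y' $ 1 $ j = (z - of_real (q x) + of_real m) * Y x $ 2 $ j \<and>
            Y' $ 2 $ j = - (z - of_real (q x) - of_real m) * Y x $ 1 $ j)"
    using dirac_solution_entries[OF sol] by blast
  have "abs_continuous_on 0 a (\<lambda>x. Y x $ 1 $ 1 * Y x $ 2 $ 2 + - (Y x $ 1 $ 2 * Y x $ 2 $ 1))"
    by (intro abs_continuous_on_add abs_continuous_on_mult acE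
        abs_continuous_on_bounded_linear[OF abs_continuous_on_mult[OF acE acE] bounded_linear_minus[OF bounded_linear_ident]])
  then have "abs_continuous_on 0 a (\<lambda>x. det (Y x))" by (simp add: det_2)
  moreover have "((\<lambda>x. det (Y x)) has_vector_derivative 0) (at x within {0..a})" if "x \<in> {0..a} - N" for x
  proof -
    obtain Y' where Y': "(Y has_vector_derivative Y') (at x)"
       "\<And>j. Y' $ 1 $ j = (z - of_real (q x) + of_real m) * Y x $ 2 $ j"
       "\<And>j. Y' $ 2 $ j = - (z - of_real (q x) - of_real m) * Y x $ 1 $ j"
      using der[of x] \<open>x \<in> {0..a} - N\<close> by blast
    have e: "((\<lambda>x. Y x $ i $ j) has_vector_derivative Y' $ i $ j) (at x)" for i j
      by (rule bounded_linear.has_vector_derivative[OF bounded_linear_entry Y'(1)])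
    have "((\<lambda>x. Y x $ 1 $ 1 * Y x $ 2 $ 2 - Y x $ 1 $ 2 * Y x $ 2 $ 1) has_vector_derivative
        (Y x $ 1 $ 1 * Y' $ 2 $ 2 + Y' $ 1 $ 1 * Y x $ 2 $ 2)
         - (Y x $ 1 $ 2 * Y' $ 2 $ 1 + Y' $ 1 $ 2 * Y x $ 2 $ 1)) (at x)"
      by (intro has_vector_derivative_diff has_vector_derivative_mult e)
    then have "((\<lambda>x. det (Y x)) has_vector_derivative 0) (at x)"
      unfolding det_2 Y'(2,3) by (simp add: algebra_simps)
    then show ?thesis by (rule has_vector_derivative_at_within)
  qed
  ultimately have "((\<lambda>x. 0) has_integral det (Y a) - det (Y 0)) {0..a}"
    by (intro abs_continuous_on_has_integral[OF _ \<open>a \<ge> 0\<close> N])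
  then show ?thesis by (metis has_integral_0_eq right_minus_eq)
qed

text \<open>For \<open>s = \<plusminus> \<i>\<close> these are the coordinates diagonalising \<open>\<sigma>\<^sub>2\<close>.\<close>

definition chiral :: "complex \<Rightarrow> complex^2 \<Rightarrow> complex" where
  "chiral s w = w $ 1 + s * w $ 2"

lemma chiral_scale: "chiral s (c *s w) = c * chiral s w"
  by (simp add: chiral_def algebra_simps)

text \<open>Parallelogram law for the first component and \<i> times the second.\<close>

lemma chiral_norm: "(cmod (chiral (- \<i>) w))\<^sup>2 + (cmod (chiral \<i> w))\<^sup>2 = 2 * (norm w)\<^sup>2"
proof -
  have "(norm w)\<^sup>2 = (cmod (w $ 1))\<^sup>2 + (cmod (w $ 2))\<^sup>2"
    by (simp add: norm_vec_def L2_set_def sum_2)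
  then show ?thesis
    unfolding chiral_def cmod_power2 by (simp add: power2_eq_square algebra_simps)
qed

lemma bounded_linear_chiral: "bounded_linear (\<lambda>A::complex^2^2. chiral s (A *v v))"
proof -
  have "linear (\<lambda>A::complex^2^2. chiral s (A *v v))"
    by (rule linearI) (simp_all add: chiral_def matrix_vector_mult_def sum_2 algebra_simps)
  then show ?thesis by (simp add: linear_conv_bounded_linear)
qed

text \<open>Since \<open>q\<close> is real, it cancels from the derivatives of the squared moduli; these derivatives are
  therefore continuous, and hold everywhere rather than almost everywhere.\<close>

lemma dirac_solution_chiral_derivative:
  fixes v :: "complex^2"
  assumes sol: "dirac_solution m q (Complex \<mu> \<alpha>) Y"
  defines "u \<equiv> \<lambda>x. chiral (- \<i>) (Y x *v v)" and "w \<equiv> \<lambda>x. chiral \<i> (Y x *v v)"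
  defines "c \<equiv> \<lambda>x. 2 * m * Im (w x * cnj (u x))"
  assumes x: "x \<in> {0..a}"
  shows "((\<lambda>x. (cmod (u x))\<^sup>2) has_real_derivative - 2 * \<alpha> * (cmod (u x))\<^sup>2 + c x) (at x within {0..a})"
    and "((\<lambda>x. (cmod (w x))\<^sup>2) has_real_derivative 2 * \<alpha> * (cmod (w x))\<^sup>2 + c x) (at x within {0..a})"
proof -
  have ac: "abs_continuous_on 0 a Y"
    using sol by (simp add: dirac_solution_def locally_abs_continuous_def)
  have acu: "abs_continuous_on 0 a u" and acw: "abs_continuous_on 0 a w"
    unfolding u_def w_def by (rule abs_continuous_on_bounded_linear[OF ac bounded_linear_chiral])+
  \<comment> \<open>Writing the squared modulus as the real part of \<open>f x * cnj (f x)\<close>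
    reduces its absolute continuity to products and bounded linear maps.\<close>
  have sq: "abs_continuous_on 0 a (\<lambda>x. (cmod (f x))\<^sup>2)" if "abs_continuous_on 0 a f" for f
  proof -
    have "abs_continuous_on 0 a (\<lambda>x. Re (f x * cnj (f x)))"
      by (intro abs_continuous_on_bounded_linear[OF _ bounded_linear_Re] abs_continuous_on_mult
            abs_continuous_on_bounded_linear[OF _ bounded_linear_cnj] that)
    then show ?thesis unfolding cmod_power2 by (simp add: power2_eq_square)
  qed
  have cont: "continuous_on {0..a} u" "continuous_on {0..a} w"
    using acu acw abs_continuous_on_imp_continuous_on by auto
  obtain N where N: "negligible N"
    and der: "\<And>x. x \<notin> N \<Longrightarrow> \<exists>Y'. (Y has_vector_derivative Y') (at x) \<and>
       (\<forall>j. Y' $ 1 $ j = (Complex \<mu> \<alpha> - of_real (q x) + of_real m) * Y x $ 2 $ j \<and>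
            Y' $ 2 $ j = - (Complex \<mu> \<alpha> - of_real (q x) - of_real m) * Y x $ 1 $ j)"
    using dirac_solution_entries[OF sol] by blast
  have sqd: "((\<lambda>x. (cmod (f x))\<^sup>2) has_real_derivative 2 * Re (f' * cnj (f y))) (at y)"
    if "(f has_vector_derivative f') (at y)" for f f' y
  proof -
    have re: "((\<lambda>x. Re (f x)) has_real_derivative Re f') (at y)"
      and im: "((\<lambda>x. Im (f x)) has_real_derivative Im f') (at y)"
      using bounded_linear.has_vector_derivative[OF bounded_linear_Re that]
        bounded_linear.has_vector_derivative[OF bounded_linear_Im that]
      by (simp_all add: has_real_derivative_iff_has_vector_derivative)
    show ?thesis
      unfolding cmod_power2
      using DERIV_add[OF DERIV_power[OF re, of 2] DERIV_power[OF im, of 2]] by (simp add: algebra_simps)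
  qed
  have ae: "((\<lambda>x. (cmod (u x))\<^sup>2) has_real_derivative - 2 * \<alpha> * (cmod (u y))\<^sup>2 + c y) (at y)"
           "((\<lambda>x. (cmod (w x))\<^sup>2) has_real_derivative 2 * \<alpha> * (cmod (w y))\<^sup>2 + c y) (at y)"
    if y: "y \<in> {0..a} - N" for y
  proof -
    obtain Y' where Y': "(Y has_vector_derivative Y') (at y)"
       "\<And>j. Y' $ 1 $ j = (Complex \<mu> \<alpha> - of_real (q y) + of_real m) * Y y $ 2 $ j"
       "\<And>j. Y' $ 2 $ j = - (Complex \<mu> \<alpha> - of_real (q y) - of_real m) * Y y $ 1 $ j"
      using der[of y] y by blast
    \<comment> \<open>The whole effect of \<open>q\<close> and \<open>\<mu>\<close> sits in the real
      part of \<open>\<zeta>\<close>; the squared moduli will see only its imaginary part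
      \<open>\<alpha>\<close>.\<close>
    define \<zeta> where "\<zeta> = Complex \<mu> \<alpha> - of_real (q y)"
    have \<zeta>: "Im \<zeta> = \<alpha>" by (simp add: \<zeta>_def)
    \<comment> \<open>The chiral coordinates diagonalise everything except the mass term, which
      alone couples \<open>u\<close> and \<open>w\<close>.\<close>
    have u': "chiral (- \<i>) (Y' *v v) = \<i> * \<zeta> * u y - \<i> * of_real m * w y"
      and w': "chiral \<i> (Y' *v v) = - \<i> * \<zeta> * w y + \<i> * of_real m * u y"
      by (simp_all add: u_def w_def chiral_def matrix_vector_mult_def sum_2 Y'(2,3) flip: \<zeta>_def)
         (simp_all add: algebra_simps)
    have "(u has_vector_derivative \<i> * \<zeta> * u y - \<i> * of_real m * w y) (at y)"
      "(w has_vector_derivative - \<i> * \<zeta> * w y + \<i> * of_real m * u y) (at y)"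
      using bounded_linear.has_vector_derivative[OF bounded_linear_chiral Y'(1), of _ v]
      unfolding u_def w_def u'[unfolded u_def w_def, symmetric] w'[unfolded u_def w_def, symmetric] by blast+
    moreover have "2 * Re ((\<i> * \<zeta> * u y - \<i> * of_real m * w y) * cnj (u y)) = - 2 * \<alpha> * (cmod (u y))\<^sup>2 + c y"
      "2 * Re ((- \<i> * \<zeta> * w y + \<i> * of_real m * u y) * cnj (w y)) = 2 * \<alpha> * (cmod (w y))\<^sup>2 + c y"
      unfolding c_def cmod_power2 by (simp_all add: \<zeta> power2_eq_square algebra_simps)
    ultimately
    show "((\<lambda>x. (cmod (u x))\<^sup>2) has_real_derivative - 2 * \<alpha> * (cmod (u y))\<^sup>2 + c y) (at y)"
         "((\<lambda>x. (cmod (w x))\<^sup>2) has_real_derivative 2 * \<alpha> * (cmod (w y))\<^sup>2 + c y) (at y)"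
      using sqd by metis+
  qed
  have cc: "continuous_on {0..a} (\<lambda>x. - 2 * \<alpha> * (cmod (u x))\<^sup>2 + c x)"
    "continuous_on {0..a} (\<lambda>x. 2 * \<alpha> * (cmod (w x))\<^sup>2 + c x)"
    unfolding c_def by (intro continuous_intros cont)+
  note ae = ae[unfolded has_real_derivative_iff_has_vector_derivative]
  show "((\<lambda>x. (cmod (u x))\<^sup>2) has_real_derivative - 2 * \<alpha> * (cmod (u x))\<^sup>2 + c x) (at x within {0..a})"
    unfolding has_real_derivative_iff_has_vector_derivative
    by (rule abs_continuous_on_has_vector_derivative[OF sq[OF acu] N ae(1) cc(1) x])
  show "((\<lambda>x. (cmod (w x))\<^sup>2) has_real_derivative 2 * \<alpha> * (cmod (w x))\<^sup>2 + c x) (at x within {0..a})"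
    unfolding has_real_derivative_iff_has_vector_derivative
    by (rule abs_continuous_on_has_vector_derivative[OF sq[OF acw] N ae(2) cc(2) x])
qed

section \<open>Floquet multipliers and Floquet solutions off the real axis\<close>

lemma eigenvector_exists_2:
  fixes M :: "complex^2^2"
  assumes "\<rho>\<^sup>2 - trace M * \<rho> + det M = 0"
  obtains v where "eigenvector_for M \<rho> v"
proof -
  have eq: "(\<rho> - M $ 1 $ 1) * (\<rho> - M $ 2 $ 2) = M $ 1 $ 2 * M $ 2 $ 1"
    using assms by (simp add: trace_def det_2 sum_2 power2_eq_square algebra_simps)
  \<comment> \<open>The candidate read off from the first row of the eigenvalue equation works
    unless it vanishes, then the one from the second row; if both vanish, the matrix is \<rho> times
    the identity and any nonzero vector serves.\<close>
  have "\<exists>p q. (p \<noteq> 0 \<or> q \<noteq> 0) \<and> M $ 1 $ 1 * p + M $ 1 $ 2 * q = \<rho> * p \<and> M $ 2 $ 1 * p + M $ 2 $ 2 * q = \<rho> * q"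
  proof (cases "M $ 1 $ 2 = 0 \<and> M $ 1 $ 1 = \<rho>")
    case False
    then show ?thesis using eq
      by (intro exI[of _ "M $ 1 $ 2"] exI[of _ "\<rho> - M $ 1 $ 1"]) (auto simp: algebra_simps)
  next
    case T: True
    show ?thesis
    proof (cases "M $ 2 $ 1 = 0 \<and> M $ 2 $ 2 = \<rho>")
      case False
      then show ?thesis using T
        by (intro exI[of _ "\<rho> - M $ 2 $ 2"] exI[of _ "M $ 2 $ 1"]) (auto simp: algebra_simps)
    next
      case True
      then show ?thesis using T by (intro exI[of _ 0] exI[of _ 1]) auto
    qed
  qed
  then obtain p q where pq: "p \<noteq> 0 \<or> q \<noteq> 0" "M $ 1 $ 1 * p + M $ 1 $ 2 * q = \<rho> * p"
    "M $ 2 $ 1 * p + M $ 2 $ 2 * q = \<rho> * q" by blast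
  have "eigenvector_for M \<rho> (vector [p, q])"
    using pq by (auto simp: eigenvector_for_def vec_eq_iff forall_2 matrix_vector_mult_def sum_2)
  then show ?thesis by (rule that)
qed

text \<open>As the determinant is 1, a discriminant in this interval would produce a multiplier of
  modulus 1. The squared moduli of the chiral coordinates would then agree at 0 and
  \<open>a\<close>, against the strict decrease of their difference. Thus Floquet eigenvectors are
  available for every positive \<open>\<alpha>\<close>.\<close>

lemma discriminant_not_in_real_interval:
  assumes F: "fundamental_matrix m q \<Phi>" and "a > 0" "\<alpha> > 0"
  shows "discriminant a \<Phi> (Complex \<mu> \<alpha>) \<notin> of_real ` {-2..2}"
proof
  let ?z = "Complex \<mu> \<alpha>"
  assume "discriminant a \<Phi> ?z \<in> of_real ` {-2..2}"
  then obtain t where "t \<in> {-2..2}" "trace (\<Phi> a ?z) = of_real t"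
    unfolding discriminant_def monodromy_def by blast
  then have t: "\<bar>t\<bar> \<le> 2" "trace (\<Phi> a ?z) = of_real t" by auto
  have sol: "dirac_solution m q ?z (\<lambda>x. \<Phi> x ?z)" and init: "\<Phi> 0 ?z = mat 1"
    using F by (auto simp: fundamental_matrix_def)
  have det: "det (\<Phi> a ?z) = 1"
    using dirac_solution_det[OF sol, of a] init \<open>a > 0\<close> by simp
  \<comment> \<open>With \<open>t\<close> equal to twice the cosine of the angle,
    \<open>\<rho>\<close> and its conjugate have sum \<open>t\<close> and product 1, so they solve
    the characteristic equation.\<close>
  define \<rho> where "\<rho> = cis (arccos (t / 2))"
  have t': "of_real t = \<rho> + cnj \<rho>"
    using t by (simp add: \<rho>_def complex_eq_iff)
  have "\<rho>\<^sup>2 - of_real t * \<rho> + 1 = 1 - \<rho> * cnj \<rho>"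
    unfolding t' by (simp add: power2_eq_square algebra_simps)
  moreover have "\<rho> * cnj \<rho> = 1" by (simp add: \<rho>_def complex_norm_square[symmetric])
  ultimately have "\<rho>\<^sup>2 - trace (\<Phi> a ?z) * \<rho> + det (\<Phi> a ?z) = 0"
    by (simp add: t(2) det)
  then obtain v where v: "v \<noteq> 0" "\<Phi> a ?z *v v = \<rho> *s v"
    by (rule eigenvector_exists_2) (auto simp: eigenvector_for_def)
  note d = dirac_solution_chiral_derivative[OF sol, where v = v]
  have "cmod \<rho> = 1" by (simp add: \<rho>_def)
  moreover have "(cmod (chiral (- \<i>) (\<Phi> a ?z *v v)))\<^sup>2 - (cmod (chiral \<i> (\<Phi> a ?z *v v)))\<^sup>2
      < (cmod (chiral (- \<i>) (\<Phi> 0 ?z *v v)))\<^sup>2 - (cmod (chiral \<i> (\<Phi> 0 ?z *v v)))\<^sup>2"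
    by (rule hyperbolic_pair_strict_decrease(2)[OF \<open>a > 0\<close> \<open>\<alpha> > 0\<close> _ _ d])
       (use v(1) in \<open>auto simp: chiral_norm init\<close>)
  ultimately show False by (simp add: v(2) chiral_scale init norm_mult)
qed

text \<open>The sign \<open>s\<close> treats both Floquet solutions at once: 1 is the growing and -1
  the decaying one. The exponential prefactor of \<open>\<psi>\<close> cancels exactly the exponent
  \<open>Im \<kappa>\<close> that the multiplier imposes, leaving only the error of the growth or
  decay estimate.\<close>

lemma floquet_log_bound:
  assumes F: "fundamental_matrix m q \<Phi>" and "m \<ge> 0" "a > 0" "\<alpha> > 0" and \<kappa>: "Im \<kappa> \<ge> 0"
    and s: "s \<in> {1, -1}"
    and ev: "eigenvector_for (monodromy a \<Phi> (Complex \<mu> \<alpha>)) (exp (- (s * \<i> * \<kappa> * of_real a))) v"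
    and x: "x \<in> {0..a}"
  defines "\<psi> \<equiv> \<lambda>x. exp (s * \<i> * \<kappa> * of_real x) *s (\<Phi> x (Complex \<mu> \<alpha>) *v v)"
  shows "norm (\<psi> x) > 0" and "\<bar>ln (norm (\<psi> x) / norm (\<psi> 0))\<bar> \<le> 3 * m\<^sup>2 * a / \<alpha>"
proof -
  let ?z = "Complex \<mu> \<alpha>"
  have sol: "dirac_solution m q ?z (\<lambda>x. \<Phi> x ?z)" and init: "\<Phi> 0 ?z = mat 1"
    using F by (auto simp: fundamental_matrix_def)
  have v: "v \<noteq> 0" "\<Phi> a ?z *v v = exp (- (s * \<i> * \<kappa> * of_real a)) *s v"
    using ev by (auto simp: eigenvector_for_def monodromy_def)
  define y where "y x = \<Phi> x ?z *v v" for x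
  define U W where "U x = (cmod (chiral (- \<i>) (y x)))\<^sup>2" and "W x = (cmod (chiral \<i> (y x)))\<^sup>2" for x
  define c where "c x = 2 * m * Im (chiral \<i> (y x) * cnj (chiral (- \<i>) (y x)))" for x
  have UW: "U x + W x = 2 * (norm (y x))\<^sup>2" for x by (simp add: U_def W_def chiral_norm)
  have y0: "y 0 = v" by (simp add: y_def init)
  have nonneg: "U x \<ge> 0" "W x \<ge> 0" for x by (simp_all add: U_def W_def)
  have c: "\<bar>c x\<bar> \<le> 2 * m * (sqrt (U x) * sqrt (W x))" for x
  proof -
    have "\<bar>c x\<bar> = 2 * m * \<bar>Im (chiral \<i> (y x) * cnj (chiral (- \<i>) (y x)))\<bar>"
      using \<open>m \<ge> 0\<close> by (simp add: c_def abs_mult)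
    also have "\<dots> \<le> 2 * m * cmod (chiral \<i> (y x) * cnj (chiral (- \<i>) (y x)))"
      using \<open>m \<ge> 0\<close> by (intro mult_left_mono abs_Im_le_cmod) auto
    finally show ?thesis by (simp add: U_def W_def norm_mult mult.commute)
  qed
  have d: "(U has_real_derivative - 2 * \<alpha> * U x + c x) (at x within {0..a})"
    "(W has_real_derivative 2 * \<alpha> * W x + c x) (at x within {0..a})" if "x \<in> {0..a}" for x
    using dirac_solution_chiral_derivative[OF sol that, where v = v]
    unfolding U_def[abs_def] W_def[abs_def] c_def y_def by auto
  have pos: "U 0 + W 0 > 0" using v by (simp add: UW y0)
  define \<sigma> where "\<sigma> = Re s"
  have s': "s = of_real \<sigma>" "\<sigma> \<in> {1, -1}" using s by (auto simp: \<sigma>_def)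
  have cm: "cmod (exp (s * \<i> * \<kappa> * of_real x)) = exp (- \<sigma> * Im \<kappa> * x)"
     "cmod (exp (- (s * \<i> * \<kappa> * of_real x))) = exp (\<sigma> * Im \<kappa> * x)" for x
    by (simp_all add: s'(1) norm_exp_eq_Re)
  \<comment> \<open>Squared moduli are multiplied by the squared modulus of the multiplier, which
    has the form required by the pair estimates with exponent \<open>Im \<kappa>\<close>.\<close>
  have "(exp (\<sigma> * Im \<kappa> * a))\<^sup>2 = exp (\<sigma> * 2 * Im \<kappa> * a)" by (simp add: exp_double[symmetric] algebra_simps)
  then have per: "U a = exp (\<sigma> * 2 * Im \<kappa> * a) * U 0" "W a = exp (\<sigma> * 2 * Im \<kappa> * a) * W 0"
    unfolding U_def W_def y0 by (simp_all add: y_def v(2) chiral_scale norm_mult power_mult_distrib cm del: norm_exp_eq_Re)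
  have N: "U x + W x > 0 \<and> \<bar>ln ((U x + W x) / (U 0 + W 0)) - \<sigma> * 2 * Im \<kappa> * x\<bar> \<le> 6 * m\<^sup>2 * a / \<alpha>"
  proof (cases "\<sigma> = 1")
    case True
    then show ?thesis
      using hyperbolic_pair_growth[OF \<open>a > 0\<close> \<open>\<alpha> > 0\<close> \<open>m \<ge> 0\<close> \<kappa> nonneg c d _ _ pos x] per by simp
  next
    case False
    then show ?thesis
      using hyperbolic_pair_decay[OF \<open>a > 0\<close> \<open>\<alpha> > 0\<close> \<open>m \<ge> 0\<close> \<kappa> nonneg c d _ _ pos x] per s' by simp
  qed
  then have yx: "norm (y x) > 0" by (simp add: UW)
  have \<psi>: "norm (\<psi> x) = exp (- \<sigma> * Im \<kappa> * x) * norm (y x)" for x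
  proof -
    have "norm (k *s w) = cmod k * norm w" for k and w :: "complex^2"
      by (simp add: norm_vec_def L2_set_def sum_2 norm_mult power_mult_distrib
            distrib_left[symmetric] real_sqrt_mult)
    then show ?thesis by (simp add: \<psi>_def cm y_def del: norm_exp_eq_Re)
  qed
  show "norm (\<psi> x) > 0" using yx by (simp add: \<psi>)
  \<comment> \<open>The sum \<open>U + W\<close> is twice the square of the norm, so its logarithm
    counts that of the norm twice and the constant 6 halves to 3.\<close>
  have "ln ((U x + W x) / (U 0 + W 0)) = 2 * ln (norm (y x) / norm v)"
    using yx v by (simp add: UW y0 ln_div ln_realpow)
  moreover have "ln (norm (\<psi> x) / norm (\<psi> 0)) = ln (norm (y x) / norm v) - \<sigma> * Im \<kappa> * x"
    using yx v by (simp add: \<psi> y0 ln_div ln_mult)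
  ultimately have "ln ((U x + W x) / (U 0 + W 0)) - \<sigma> * 2 * Im \<kappa> * x = 2 * ln (norm (\<psi> x) / norm (\<psi> 0))"
    by (simp add: algebra_simps)
  then have "\<bar>2 * ln (norm (\<psi> x) / norm (\<psi> 0))\<bar> \<le> 6 * m\<^sup>2 * a / \<alpha>" using N by simp
  then show "\<bar>ln (norm (\<psi> x) / norm (\<psi> 0))\<bar> \<le> 3 * m\<^sup>2 * a / \<alpha>" by simp
qed

theorem theorem9:
  fixes m a \<mu> :: real and q :: "real \<Rightarrow> real"
    and \<Phi> :: "real \<Rightarrow> complex \<Rightarrow> complex^2^2"
    and k :: "complex \<Rightarrow> complex" and vp vm :: "complex \<Rightarrow> complex^2"
  assumes "m \<ge> 0" and "a > 0"
    and "locally_integrable q" and "\<And>x. q (x + a) = q x"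
    and "fundamental_matrix m q \<Phi>"
    and "quasimomentum a \<Phi> k"
    and "floquet_eigenvectors a \<Phi> k vp vm"
  shows "(\<forall>\<phi>\<in>{phi_plus \<Phi> k vp, phi_minus \<Phi> k vm}.
            (\<exists>r. unif_bigo a r (\<lambda>\<alpha>. 1 / \<alpha>) \<and>
               (\<forall>\<alpha>>0. \<forall>x\<in>{0..a}. norm (\<phi> x (Complex \<mu> \<alpha>))
                  = norm (\<phi> 0 (Complex \<mu> \<alpha>)) * (1 + r x \<alpha>))) \<and>
            (\<lambda>\<alpha>. gamma_quot a \<phi> (Complex \<mu> \<alpha>) - 1) \<in> O[at_top](\<lambda>\<alpha>. 1 / \<alpha>))"
proof
  fix \<phi> assume \<phi>: "\<phi> \<in> {phi_plus \<Phi> k vp, phi_minus \<Phi> k vm}"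
  have *: "norm (\<phi> x (Complex \<mu> \<alpha>)) > 0 \<and>
      \<bar>ln (norm (\<phi> x (Complex \<mu> \<alpha>)) / norm (\<phi> 0 (Complex \<mu> \<alpha>)))\<bar> \<le> 3 * m\<^sup>2 * a / \<alpha>"
    if \<alpha>: "\<alpha> > 0" and x: "x \<in> {0..a}" for x \<alpha>
  proof -
    let ?z = "Complex \<mu> \<alpha>"
    \<comment> \<open>The discriminant avoids the exceptional interval at every positive
      \<open>\<alpha>\<close>, so the eigenvector property may be used without a lower
      threshold.\<close>
    have ev: "eigenvector_for (monodromy a \<Phi> ?z) (exp (- \<i> * k ?z * of_real a)) (vp ?z)"
       "eigenvector_for (monodromy a \<Phi> ?z) (exp (\<i> * k ?z * of_real a)) (vm ?z)"
      using assms(7) discriminant_not_in_real_interval[OF assms(5,2) \<alpha>] \<alpha>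
      by (auto simp: floquet_eigenvectors_def)
    have \<kappa>: "Im (k ?z) \<ge> 0" using assms(6) \<alpha> by (simp add: quasimomentum_def)
    show ?thesis
    proof (cases "\<phi> = phi_plus \<Phi> k vp")
      case True
      then show ?thesis
        using floquet_log_bound[OF assms(5,1,2) \<alpha> \<kappa>, of 1 \<mu> "vp ?z" x] ev x
        by (simp add: phi_plus_def[abs_def])
    next
      case False
      then have "\<phi> = phi_minus \<Phi> k vm" using \<phi> by simp
      then show ?thesis
        using floquet_log_bound[OF assms(5,1,2) \<alpha> \<kappa>, of "-1" \<mu> "vm ?z" x] ev x
        by (simp add: phi_minus_def[abs_def])
    qed
  qed
  have "3 * m\<^sup>2 * a \<ge> 0" using \<open>a > 0\<close> by simp
  then show "(\<exists>r. unif_bigo a r (\<lambda>\<alpha>. 1 / \<alpha>) \<and>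
               (\<forall>\<alpha>>0. \<forall>x\<in>{0..a}. norm (\<phi> x (Complex \<mu> \<alpha>))
                  = norm (\<phi> 0 (Complex \<mu> \<alpha>)) * (1 + r x \<alpha>))) \<and>
            (\<lambda>\<alpha>. gamma_quot a \<phi> (Complex \<mu> \<alpha>) - 1) \<in> O[at_top](\<lambda>\<alpha>. 1 / \<alpha>)"
    using phi_asymptotics_of_log_bound[OF \<open>a > 0\<close>, of "3 * m\<^sup>2 * a" \<phi> \<mu>] * by blast
qed

end
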